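(* Let $(M,f)$ be a (possibly degenerate) bilinear lattice. The assignment $c\mapsto \phi_{f,c}$ induces a well-defined injective map $$\phi_f:\mathrm{Char}(f)/2\widehat f(M)\hookrightarrow \mathrm{Quad}(L_f),\qquad [c]\mapsto \phi_{f,c},$$ which is affine over the opposite of the group monomorphism $\mathrm{Coker}\,\widehat f\hookrightarrow \mathrm{Hom}(G_f,\mathbb Q/\mathbb Z)$, $[\alpha]\mapsto\langle[\alpha],-\rangle$; that is, $\phi_f([\alpha]\cdot[c])=\phi_f([c])-\langle[\alpha],-\rangle$ for all $[\alpha]\in\mathrm{Coker}\,\widehat f$ and all $[c]$. Furthermore, $$\mathrm{Coker}\,\phi_f\simeq \mathrm{Coker}\,j_f=\frac{(\mathrm{Ker}\,\widehat L_f)^*}{j_f\big((\mathrm{Ker}\,\widehat f)^*\big)},$$ and, given $q\in \mathrm{Quad}(L_f)$, the following two assertions are equivalent: (i) $q\in\mathrm{Im}\,\phi_f$; (ii) $q|_{\mathrm{Ker}\,\widehat L_f}\in\mathrm{Im}\,j_f$.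
   Context: A bilinear lattice $(M,f)$ is a finitely generated free abelian group $M$ with a symmetric bilinear form $f:M\times M\to\mathbb Z$. Put $V=M\otimes\mathbb Q$, let $f_{\mathbb Q}:V\times V\to\mathbb Q$ be the extension of $f$, $M^*=\mathrm{Hom}(M,\mathbb Z)$, $\widehat f:M\to M^*$, $\widehat f(x)=f(x,-)$, and $\mathrm{Coker}\,\widehat f=M^*/\widehat f(M)$. For $\alpha\in M^*$, $\alpha_{\mathbb Q}:V\to\mathbb Q$ is its linear extension. A characteristic form for $f$ is $c\in M^*$ with $f(x,x)-c(x)\in2\mathbb Z$ for all $x\in M$; $\mathrm{Char}(f)$ is the set of them. $\mathrm{Coker}\,\widehat f$ acts freely and transitively on $\mathrm{Char}(f)/2\widehat f(M)$ by $[\alpha]\cdot[c]=[c+2\alpha]$. Dual lattice: $M^\sharp=\{x\in V: f_{\mathbb Q}(x,M)\subset\mathbb Z\}\supset M$. Set $G_f=M^\sharp/M$ (a torsion group) and $L_f:G_f\times G_f\to\mathbb Q/\mathbb Z$, $L_f([x],[y])=f_{\mathbb Q}(x,y)\bmod\mathbb Z$. Let $\widehat L_f:G_f\to\mathrm{Hom}(G_f,\mathbb Q/\mathbb Z)$ be its adjoint. A quadratic function on a torsion abelian group $G$ is a map $q:G\to\mathbb Q/\mathbb Z$ such that $b_q(x,y)=q(x+y)-q(x)-q(y)$ is bilinear. For a symmetric bilinear $b:G\times G\to\mathbb Q/\mathbb Z$, $\mathrm{Quad}(b)$ is the set of quadratic functions $q$ with $b_q=b$; it is an affine space over $\mathrm{Hom}(G,\mathbb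 Q/\mathbb Z)$ (acting by addition of functions). For $c\in\mathrm{Char}(f)$, $\phi_{f,c}\in\mathrm{Quad}(L_f)$ is defined by $\phi_{f,c}([x])=\tfrac12\big(f_{\mathbb Q}(x,x)-c_{\mathbb Q}(x)\big)\bmod\mathbb Z$, $x\in M^\sharp$. The pairing $\langle-,-\rangle:\mathrm{Coker}\,\widehat f\times G_f\to\mathbb Q/\mathbb Z$ is $\langle[\alpha],[x]\rangle=\alpha_{\mathbb Q}(x)\bmod\mathbb Z$. Dual groups: $(\mathrm{Ker}\,\widehat f)^*=\mathrm{Hom}(\mathrm{Ker}\,\widehat f,\mathbb Z)$, $(\mathrm{Ker}\,\widehat L_f)^*=\mathrm{Hom}(\mathrm{Ker}\,\widehat L_f,\mathbb Q/\mathbb Z)$. One has $\mathrm{Ker}\,\widehat L_f=(M+\mathrm{Ker}\,\widehat f_{\mathbb Q})/M=(\mathrm{Ker}\,\widehat f)\otimes\mathbb Q/\mathbb Z$, and $j_f:(\mathrm{Ker}\,\widehat f)^*\to(\mathrm{Ker}\,\widehat L_f)^*$ sends a homomorphism $g$ to $g\otimes\mathbb Q/\mathbb Z$. The cokernel $\mathrm{Coker}\,\phi_f$ of the affine map $\phi_f$ means the quotient of $\mathrm{Hom}(G_f,\mathbb Q/\mathbb Z)$ by the image of the underlying homomorphism $[\alpha]\mapsto\langle[\alpha],-\rangle$. Restricted to $\mathrm{Ker}\,\widehat L_f$, any $q\in\mathrm{Quad}(L_f)$ is a homomorphism. *)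

theory Defs
  imports "HOL-Algebra.Free_Abelian_Groups"
begin

text \<open>
  Groups are HOL-Algebra records, hence written multiplicatively in the code; the comments use
  additive notation. A map that is determined by its values on classes is written
  \<open>the_elem (h ` X)\<close>, the common value of \<open>h\<close> on all representatives in \<open>X\<close>.
\<close>

section \<open>Homomorphism groups, tensor products and the group Q/Z\<close>

text \<open>Homomorphisms are made extensional so that each one is a single HOL function.\<close>

definition hom_group ::
  "('a, 'm) monoid_scheme \<Rightarrow> ('b, 'n) monoid_scheme \<Rightarrow> ('a \<Rightarrow> 'b) monoid" where
  "hom_group G H =
     \<lparr>carrier = hom G H \<inter> extensional (carrier G),
      monoid.mult = (\<lambda>g h. \<lambda>x\<in>carrier G. g x \<otimes>\<^bsub>H\<^esub> h x),
      one = (\<lambda>x\<in>carrier G. \<one>\<^bsub>H\<^esub>)\<rparr>"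

definition tensor_rels ::
  "('a, 'm) monoid_scheme \<Rightarrow> ('b, 'n) monoid_scheme \<Rightarrow> ('a \<times> 'b \<Rightarrow>\<^sub>0 int) set" where
  "tensor_rels A B =
     {frag_of (a \<otimes>\<^bsub>A\<^esub> a', b) - frag_of (a, b) - frag_of (a', b) | a a' b.
        a \<in> carrier A \<and> a' \<in> carrier A \<and> b \<in> carrier B} \<union>
     {frag_of (a, b \<otimes>\<^bsub>B\<^esub> b') - frag_of (a, b) - frag_of (a, b') | a b b'.
        a \<in> carrier A \<and> b \<in> carrier B \<and> b' \<in> carrier B}"

definition tensor_rel_group ::
  "('a, 'm) monoid_scheme \<Rightarrow> ('b, 'n) monoid_scheme \<Rightarrow> ('a \<times> 'b \<Rightarrow>\<^sub>0 int) set" where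
  "tensor_rel_group A B =
     generate (free_Abelian_group (carrier A \<times> carrier B)) (tensor_rels A B)"

definition tensor_group ::
  "('a, 'm) monoid_scheme \<Rightarrow> ('b, 'n) monoid_scheme \<Rightarrow> ('a \<times> 'b \<Rightarrow>\<^sub>0 int) set monoid" where
  "tensor_group A B = free_Abelian_group (carrier A \<times> carrier B) Mod tensor_rel_group A B"

definition pure_tensor ::
  "('a, 'm) monoid_scheme \<Rightarrow> ('b, 'n) monoid_scheme \<Rightarrow> 'a \<Rightarrow> 'b \<Rightarrow> ('a \<times> 'b \<Rightarrow>\<^sub>0 int) set" where
  "pure_tensor A B a b =
     tensor_rel_group A B #>\<^bsub>free_Abelian_group (carrier A \<times> carrier B)\<^esub> frag_of (a, b)"

text \<open>The homomorphism out of the tensor product induced by a biadditive map \<open>\<beta>\<close>.\<close>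

definition tensor_lift ::
  "('a, 'm) monoid_scheme \<Rightarrow> ('b, 'n) monoid_scheme \<Rightarrow> ('c, 'k) monoid_scheme \<Rightarrow>
   ('a \<Rightarrow> 'b \<Rightarrow> 'c) \<Rightarrow> ('a \<times> 'b \<Rightarrow>\<^sub>0 int) set \<Rightarrow> 'c" where
  "tensor_lift A B C \<beta> =
     (THE h. h \<in> carrier (hom_group (tensor_group A B) C) \<and>
        (\<forall>a\<in>carrier A. \<forall>b\<in>carrier B. h (pure_tensor A B a b) = \<beta> a b))"

definition rat_group :: "rat monoid" where
  "rat_group = \<lparr>carrier = UNIV, monoid.mult = (+), one = 0\<rparr>"

definition QZ :: "rat set monoid" where
  "QZ = rat_group Mod \<int>"

definition mod_Z :: "rat \<Rightarrow> rat set" where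
  "mod_Z r = \<int> #>\<^bsub>rat_group\<^esub> r"

section \<open>Quadratic functions\<close>

definition bilinear_QZ :: "('a, 'm) monoid_scheme \<Rightarrow> ('a \<Rightarrow> 'a \<Rightarrow> rat set) \<Rightarrow> bool" where
  "bilinear_QZ G b \<longleftrightarrow>
     (\<forall>x\<in>carrier G. \<forall>y\<in>carrier G. b x y \<in> carrier QZ) \<and>
     (\<forall>x\<in>carrier G. \<forall>y\<in>carrier G. \<forall>z\<in>carrier G.
        b (x \<otimes>\<^bsub>G\<^esub> y) z = b x z \<otimes>\<^bsub>QZ\<^esub> b y z \<and>
        b x (y \<otimes>\<^bsub>G\<^esub> z) = b x y \<otimes>\<^bsub>QZ\<^esub> b x z)"

definition polar :: "('a, 'm) monoid_scheme \<Rightarrow> ('a \<Rightarrow> rat set) \<Rightarrow> 'a \<Rightarrow> 'a \<Rightarrow> rat set" where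
  "polar G q x y = q (x \<otimes>\<^bsub>G\<^esub> y) \<otimes>\<^bsub>QZ\<^esub> inv\<^bsub>QZ\<^esub> (q x) \<otimes>\<^bsub>QZ\<^esub> inv\<^bsub>QZ\<^esub> (q y)"

definition quadratic_function :: "('a, 'm) monoid_scheme \<Rightarrow> ('a \<Rightarrow> rat set) \<Rightarrow> bool" where
  "quadratic_function G q \<longleftrightarrow>
     q \<in> carrier G \<rightarrow>\<^sub>E carrier QZ \<and> bilinear_QZ G (polar G q)"

definition Quad ::
  "('a, 'm) monoid_scheme \<Rightarrow> ('a \<Rightarrow> 'a \<Rightarrow> rat set) \<Rightarrow> ('a \<Rightarrow> rat set) set" where
  "Quad G b =
     {q. quadratic_function G q \<and> (\<forall>x\<in>carrier G. \<forall>y\<in>carrier G. polar G q x y = b x y)}"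

section \<open>Bilinear lattices and characteristic forms\<close>

locale bilinear_lattice = comm_group M for M (structure) +
  fixes f :: "'a \<Rightarrow> 'a \<Rightarrow> int"
  assumes fin_gen_free: "\<exists>n::nat. M \<cong> free_Abelian_group {..<n}"
    and f_sym: "\<lbrakk>x \<in> carrier M; y \<in> carrier M\<rbrakk> \<Longrightarrow> f x y = f y x"
    and f_add: "\<lbrakk>x \<in> carrier M; y \<in> carrier M; z \<in> carrier M\<rbrakk> \<Longrightarrow> f (x \<otimes> y) z = f x z + f y z"

definition dual :: "('a, 'm) monoid_scheme \<Rightarrow> ('a \<Rightarrow> int) monoid" where
  "dual M = hom_group M integer_group"

definition adj :: "('a, 'm) monoid_scheme \<Rightarrow> ('a \<Rightarrow> 'a \<Rightarrow> int) \<Rightarrow> 'a \<Rightarrow> 'a \<Rightarrow> int" where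
  "adj M f x = (\<lambda>y\<in>carrier M. f x y)"

definition coker_adj ::
  "('a, 'm) monoid_scheme \<Rightarrow> ('a \<Rightarrow> 'a \<Rightarrow> int) \<Rightarrow> ('a \<Rightarrow> int) set monoid" where
  "coker_adj M f = dual M Mod (adj M f ` carrier M)"

definition ker_adj ::
  "('a, 'm) monoid_scheme \<Rightarrow> ('a \<Rightarrow> 'a \<Rightarrow> int) \<Rightarrow> ('a, 'm) monoid_scheme" where
  "ker_adj M f = M\<lparr>carrier := kernel M (dual M) (adj M f)\<rparr>"

definition Char :: "('a, 'm) monoid_scheme \<Rightarrow> ('a \<Rightarrow> 'a \<Rightarrow> int) \<Rightarrow> ('a \<Rightarrow> int) set" where
  "Char M f = {c \<in> carrier (dual M). \<forall>x\<in>carrier M. even (f x x - c x)}"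

text \<open>The subgroup factored out here is \<open>2 f^(M)\<close>, the group of all doubles of \<open>f^(x)\<close>.\<close>

definition char_class ::
  "('a, 'm) monoid_scheme \<Rightarrow> ('a \<Rightarrow> 'a \<Rightarrow> int) \<Rightarrow> ('a \<Rightarrow> int) \<Rightarrow> ('a \<Rightarrow> int) set" where
  "char_class M f c =
     ((\<lambda>x. adj M f x [^]\<^bsub>dual M\<^esub> (2::nat)) ` carrier M) #>\<^bsub>dual M\<^esub> c"

definition Char_quot ::
  "('a, 'm) monoid_scheme \<Rightarrow> ('a \<Rightarrow> 'a \<Rightarrow> int) \<Rightarrow> ('a \<Rightarrow> int) set set" where
  "Char_quot M f = char_class M f ` Char M f"

text \<open>The action \<open>[\<alpha>] \<cdot> [c] = [c + 2\<alpha>]\<close> of \<open>coker_adj M f\<close> on \<open>Char_quot M f\<close>.\<close>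

definition char_act ::
  "('a, 'm) monoid_scheme \<Rightarrow> ('a \<Rightarrow> 'a \<Rightarrow> int) \<Rightarrow>
   ('a \<Rightarrow> int) set \<Rightarrow> ('a \<Rightarrow> int) set \<Rightarrow> ('a \<Rightarrow> int) set" where
  "char_act M f A C =
     the_elem ((\<lambda>(\<alpha>, c). char_class M f (c \<otimes>\<^bsub>dual M\<^esub> \<alpha> [^]\<^bsub>dual M\<^esub> (2::nat))) ` (A \<times> C))"

section \<open>The discriminant pairing and the quadratic functions of characteristic forms\<close>

type_synonym 'a rationalized = "('a \<times> rat \<Rightarrow>\<^sub>0 int) set"

definition rationalization :: "('a, 'm) monoid_scheme \<Rightarrow> 'a rationalized monoid" where
  "rationalization M = tensor_group M rat_group"

text \<open>\<open>M\<close> as a subgroup of \<open>V = M \<otimes> Q\<close>, via \<open>x \<mapsto> x \<otimes> 1\<close>.\<close>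

definition lattice_image :: "('a, 'm) monoid_scheme \<Rightarrow> 'a rationalized set" where
  "lattice_image M = (\<lambda>x. pure_tensor M rat_group x 1) ` carrier M"

definition dual_ext :: "('a, 'm) monoid_scheme \<Rightarrow> ('a \<Rightarrow> int) \<Rightarrow> 'a rationalized \<Rightarrow> rat" where
  "dual_ext M \<alpha> = tensor_lift M rat_group rat_group (\<lambda>x r. r * of_int (\<alpha> x))"

text \<open>\<open>form_ext M f (x \<otimes> r) (y \<otimes> s) = r s f(x, y)\<close>.\<close>

definition form_ext ::
  "('a, 'm) monoid_scheme \<Rightarrow> ('a \<Rightarrow> 'a \<Rightarrow> int) \<Rightarrow> 'a rationalized \<Rightarrow> 'a rationalized \<Rightarrow> rat" where
  "form_ext M f u v = tensor_lift M rat_group rat_group (\<lambda>x r. r * dual_ext M (adj M f x) v) u"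

definition dual_lattice ::
  "('a, 'm) monoid_scheme \<Rightarrow> ('a \<Rightarrow> 'a \<Rightarrow> int) \<Rightarrow> 'a rationalized set" where
  "dual_lattice M f =
     {u \<in> carrier (rationalization M). \<forall>v\<in>lattice_image M. form_ext M f u v \<in> \<int>}"

definition discr_group ::
  "('a, 'm) monoid_scheme \<Rightarrow> ('a \<Rightarrow> 'a \<Rightarrow> int) \<Rightarrow> 'a rationalized set monoid" where
  "discr_group M f = (rationalization M)\<lparr>carrier := dual_lattice M f\<rparr> Mod lattice_image M"

definition discr_class ::
  "('a, 'm) monoid_scheme \<Rightarrow> 'a rationalized \<Rightarrow> 'a rationalized set" where
  "discr_class M u = lattice_image M #>\<^bsub>rationalization M\<^esub> u"

definition discr_form ::
  "('a, 'm) monoid_scheme \<Rightarrow> ('a \<Rightarrow> 'a \<Rightarrow> int) \<Rightarrow>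
   'a rationalized set \<Rightarrow> 'a rationalized set \<Rightarrow> rat set" where
  "discr_form M f X Y = the_elem ((\<lambda>(x, y). mod_Z (form_ext M f x y)) ` (X \<times> Y))"

definition discr_adj ::
  "('a, 'm) monoid_scheme \<Rightarrow> ('a \<Rightarrow> 'a \<Rightarrow> int) \<Rightarrow>
   'a rationalized set \<Rightarrow> 'a rationalized set \<Rightarrow> rat set" where
  "discr_adj M f X = (\<lambda>Y\<in>carrier (discr_group M f). discr_form M f X Y)"

definition ker_discr_adj ::
  "('a, 'm) monoid_scheme \<Rightarrow> ('a \<Rightarrow> 'a \<Rightarrow> int) \<Rightarrow> 'a rationalized set monoid" where
  "ker_discr_adj M f =
     (discr_group M f)\<lparr>carrier :=
        kernel (discr_group M f) (hom_group (discr_group M f) QZ) (discr_adj M f)\<rparr>"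

definition phi_char ::
  "('a, 'm) monoid_scheme \<Rightarrow> ('a \<Rightarrow> 'a \<Rightarrow> int) \<Rightarrow> ('a \<Rightarrow> int) \<Rightarrow>
   'a rationalized set \<Rightarrow> rat set" where
  "phi_char M f c =
     (\<lambda>X\<in>carrier (discr_group M f).
        the_elem ((\<lambda>x. mod_Z ((form_ext M f x x - dual_ext M c x) / 2)) ` X))"

definition phi_map ::
  "('a, 'm) monoid_scheme \<Rightarrow> ('a \<Rightarrow> 'a \<Rightarrow> int) \<Rightarrow> ('a \<Rightarrow> int) set \<Rightarrow>
   'a rationalized set \<Rightarrow> rat set" where
  "phi_map M f C = the_elem (phi_char M f ` C)"

text \<open>The homomorphism \<open>[\<alpha>] \<mapsto> \<langle>[\<alpha>], -\<rangle>\<close> from \<open>coker_adj M f\<close> to \<open>Hom(G_f, Q/Z)\<close>.\<close>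

definition coker_pairing ::
  "('a, 'm) monoid_scheme \<Rightarrow> ('a \<Rightarrow> 'a \<Rightarrow> int) \<Rightarrow> ('a \<Rightarrow> int) set \<Rightarrow>
   'a rationalized set \<Rightarrow> rat set" where
  "coker_pairing M f A =
     (\<lambda>X\<in>carrier (discr_group M f). the_elem ((\<lambda>(\<alpha>, x). mod_Z (dual_ext M \<alpha> x)) ` (A \<times> X)))"

definition coker_phi ::
  "('a, 'm) monoid_scheme \<Rightarrow> ('a \<Rightarrow> 'a \<Rightarrow> int) \<Rightarrow> ('a rationalized set \<Rightarrow> rat set) set monoid" where
  "coker_phi M f =
     hom_group (discr_group M f) QZ Mod (coker_pairing M f ` carrier (coker_adj M f))"

text \<open>The identification of \<open>Ker f^ \<otimes> Q/Z\<close> with the kernel of the adjoint of the discriminant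
  form: \<open>k \<otimes> [r] \<mapsto> [k \<otimes> r]\<close>.\<close>

definition ker_ident ::
  "('a, 'm) monoid_scheme \<Rightarrow> ('a \<Rightarrow> 'a \<Rightarrow> int) \<Rightarrow>
   ('a \<times> rat set \<Rightarrow>\<^sub>0 int) set \<Rightarrow> 'a rationalized set" where
  "ker_ident M f =
     tensor_lift (ker_adj M f) QZ (ker_discr_adj M f)
       (\<lambda>k R. the_elem ((\<lambda>r. discr_class M (pure_tensor M rat_group k r)) ` R))"

text \<open>\<open>g \<otimes> Q/Z\<close>, read as a homomorphism to \<open>Q/Z\<close> through \<open>Z \<otimes> Q/Z = Q/Z\<close>: it maps
  \<open>k \<otimes> R\<close> to \<open>g(k) R\<close>.\<close>

definition tensor_QZ ::
  "('a, 'm) monoid_scheme \<Rightarrow> ('a \<Rightarrow> int) \<Rightarrow> ('a \<times> rat set \<Rightarrow>\<^sub>0 int) set \<Rightarrow> rat set" where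
  "tensor_QZ K g = tensor_lift K QZ QZ (\<lambda>k R. R [^]\<^bsub>QZ\<^esub> g k)"

definition j_map ::
  "('a, 'm) monoid_scheme \<Rightarrow> ('a \<Rightarrow> 'a \<Rightarrow> int) \<Rightarrow> ('a \<Rightarrow> int) \<Rightarrow>
   'a rationalized set \<Rightarrow> rat set" where
  "j_map M f g =
     (\<lambda>X\<in>carrier (ker_discr_adj M f).
        tensor_QZ (ker_adj M f) g
          (inv_into (carrier (tensor_group (ker_adj M f) QZ)) (ker_ident M f) X))"

definition coker_j ::
  "('a, 'm) monoid_scheme \<Rightarrow> ('a \<Rightarrow> 'a \<Rightarrow> int) \<Rightarrow> ('a rationalized set \<Rightarrow> rat set) set monoid" where
  "coker_j M f =
     hom_group (ker_discr_adj M f) QZ Mod (j_map M f ` carrier (dual (ker_adj M f)))"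

end

theory Submission
  imports Defs
begin

text \<open>
  Write \<open>V = M \<otimes> Q\<close>, let \<open>M#\<close> (\<open>Msharp\<close> in the proofs) be the dual lattice, \<open>G\<close> the discriminant
  group \<open>M# / M\<close>, \<open>K = Ker f^\<close> the radical, and \<open>KD\<close> the kernel of the adjoint of the discriminant
  form. Everything rests on one duality statement, \<open>QZ_hom_is_evaluation\<close>: a homomorphism to \<open>Q/Z\<close>
  that is given on any subgroup \<open>S\<close> of the dual \<open>M*\<close> is the evaluation, modulo \<open>Z\<close>, at a vector of \<open>V\<close>. Two choices of \<open>S\<close> yield the main steps.

  If \<open>\<alpha>\<close> is not in \<open>f^(M)\<close>, take for \<open>S\<close> the group generated by \<open>f^(M)\<close> and \<open>\<alpha>\<close>, with a homomorphism
  that kills \<open>f^(M)\<close> but not \<open>\<alpha>\<close>. The resulting vector lies in \<open>M#\<close> and \<open>\<alpha>\<close> is not integral on it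
  (\<open>integral_on_dual_lattice_imp_adj\<close>). This is the injectivity of \<open>[\<alpha>] \<mapsto> \<langle>[\<alpha>], -\<rangle>\<close>. It is also that of
  \<open>[c] \<mapsto> \<phi>_c\<close>, since two characteristic forms differ by some \<open>2 \<alpha>\<close> and \<open>\<phi>\<close> then changes by
  \<open>- \<langle>[\<alpha>], -\<rangle>\<close>. Applied to \<open>\<alpha> = f(u, -)\<close>, it shows that \<open>KD\<close> consists of the classes of the vectors
  \<open>k \<otimes> r\<close> with \<open>k\<close> in \<open>K\<close> (\<open>KD_cases\<close>).

  Now let \<open>S\<close> be the group of the forms \<open>f(u, -)\<close> with \<open>u\<close> in \<open>M#\<close>. A homomorphism \<open>h\<close> from \<open>G\<close> to \<open>Q/Z\<close>
  that vanishes on \<open>KD\<close> factors through \<open>S\<close>, so \<open>h([u]) = f(u, y)\<close> for some \<open>y\<close>, which must lie in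
  \<open>M#\<close>; hence \<open>h\<close> is the pairing with \<open>f(y, -)\<close> (\<open>hom_vanishing_on_kernel_is_pairing\<close>).

  The radical is a direct summand of \<open>M\<close> (\<open>radical_retraction\<close>). So every form on \<open>K\<close> extends to \<open>M\<close>,
  and every homomorphism from \<open>KD\<close> to \<open>Q/Z\<close> extends to \<open>G\<close>. Consequently \<open>h\<close> in \<open>Hom(G, Q/Z)\<close> is a
  pairing if and only if its restriction to \<open>KD\<close> is in the image of \<open>j\<close> (\<open>pairing_image_iff\<close>): if it is
  \<open>j(g)\<close>, extend \<open>g\<close> to \<open>M\<close> and subtract the pairing with the extension. As restriction is onto, it
  induces the isomorphism of the two cokernels.

  Finally, characteristic forms exist, and the restriction of \<open>\<phi>_c\<close> to \<open>KD\<close> is \<open>j(- c / 2)\<close>, because \<open>c\<close>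
  is even on \<open>K\<close>. For a quadratic function \<open>q\<close> with the right polarization, \<open>q - \<phi>_c\<close> is a
  homomorphism, and the criterion for \<open>q\<close> reduces to the one for homomorphisms.
\<close>

section \<open>The group Q/Z\<close>

lemma rat_group_simps [simp]:
  "carrier rat_group = UNIV" "x \<otimes>\<^bsub>rat_group\<^esub> y = x + y" "\<one>\<^bsub>rat_group\<^esub> = 0"
  by (auto simp: rat_group_def)

lemma comm_group_rat_group [simp]: "comm_group rat_group"
  by (rule comm_groupI) (auto intro: exI[of _ "- x" for x])

lemma group_rat_group [simp]: "group rat_group"
  by (simp add: comm_group.axioms(2))

lemma inv_rat_group [simp]: "inv\<^bsub>rat_group\<^esub> x = - x"
  by (rule group.inv_equality) auto

lemma nat_pow_rat_group [simp]: "x [^]\<^bsub>rat_group\<^esub> (n::nat) = of_nat n * x"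
  by (induction n) (auto simp: algebra_simps nat_pow_def)

lemma int_pow_rat_group [simp]: "x [^]\<^bsub>rat_group\<^esub> (k::int) = of_int k * x"
  by (simp add: int_pow_def2)

lemma Ints_normal: "\<int> \<lhd> rat_group"
proof -
  have "subgroup \<int> rat_group"
    by (unfold_locales) auto
  then show ?thesis
    by (simp add: comm_group.normal_iff_subgroup)
qed

lemma comm_group_QZ [simp]: "comm_group QZ"
  unfolding QZ_def by (rule comm_group.abelian_FactGroup)
    (use Ints_normal in \<open>auto simp: normal_imp_subgroup\<close>)

lemma group_QZ [simp]: "group QZ"
  by (simp add: comm_group.axioms(2))

lemma carrier_QZ: "carrier QZ = range mod_Z"
  by (auto simp: QZ_def carrier_FactGroup mod_Z_def)

lemma mod_Z_closed [simp]: "mod_Z r \<in> carrier QZ"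
  by (auto simp: carrier_QZ)

lemma mem_mod_Z_iff: "s \<in> mod_Z r \<longleftrightarrow> s - r \<in> \<int>"
  by (auto simp: mod_Z_def r_coset_def) (metis diff_add_cancel)

lemma mod_Z_eq_iff: "mod_Z r = mod_Z s \<longleftrightarrow> r - s \<in> \<int>"
proof
  assume "mod_Z r = mod_Z s"
  then show "r - s \<in> \<int>" using mem_mod_Z_iff[of r r] by (simp add: mem_mod_Z_iff)
next
  assume rs: "r - s \<in> \<int>"
  have "t - r \<in> \<int> \<longleftrightarrow> t - s \<in> \<int>" for t
    using Ints_add[OF _ rs, of "t - r"] Ints_diff[OF _ rs, of "t - s"] by (auto simp: algebra_simps)
  then show "mod_Z r = mod_Z s"
    by (auto simp: mem_mod_Z_iff)
qed

lemma mod_Z_hom: "mod_Z \<in> hom rat_group QZ"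
  unfolding QZ_def mod_Z_def by (rule normal.r_coset_hom_Mod[OF Ints_normal])

lemma mod_Z_group_hom: "group_hom rat_group QZ mod_Z"
  by (simp add: group_hom_def group_hom_axioms_def mod_Z_hom)

lemma mod_Z_mult: "mod_Z r \<otimes>\<^bsub>QZ\<^esub> mod_Z s = mod_Z (r + s)"
  using hom_mult[OF mod_Z_hom] by simp

lemma mod_Z_0: "mod_Z 0 = \<one>\<^bsub>QZ\<^esub>"
  using group_hom.hom_one[OF mod_Z_group_hom] by simp

lemma mod_Z_inv: "inv\<^bsub>QZ\<^esub> (mod_Z r) = mod_Z (- r)"
  using group_hom.hom_inv[OF mod_Z_group_hom, of r] by simp

lemma mod_Z_int_pow: "mod_Z r [^]\<^bsub>QZ\<^esub> (k::int) = mod_Z (of_int k * r)"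
  using group_hom.hom_int_pow[OF mod_Z_group_hom, of r k] by simp

lemma mod_Z_eq_one_iff: "mod_Z r = \<one>\<^bsub>QZ\<^esub> \<longleftrightarrow> r \<in> \<int>"
  using mod_Z_eq_iff[of r 0] by (simp add: mod_Z_0)

lemmas mod_Z_simps = mod_Z_mult mod_Z_inv mod_Z_int_pow

section \<open>Homomorphism groups\<close>

lemma carrier_hom_group: "carrier (hom_group G H) = hom G H \<inter> extensional (carrier G)"
  by (simp add: hom_group_def)

lemma mult_hom_group:
  "x \<in> carrier G \<Longrightarrow> (g \<otimes>\<^bsub>hom_group G H\<^esub> h) x = g x \<otimes>\<^bsub>H\<^esub> h x"
  by (simp add: hom_group_def)

lemma hom_group_eqI:
  assumes "g \<in> carrier (hom_group G H)" "h \<in> carrier (hom_group G H)"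
    and "\<And>x. x \<in> carrier G \<Longrightarrow> g x = h x"
  shows "g = h"
  using assms by (auto simp: carrier_hom_group intro: extensionalityI)

lemma hom_group_restrictI:
  "group G \<Longrightarrow> h \<in> hom G H \<Longrightarrow> restrict h (carrier G) \<in> carrier (hom_group G H)"
  by (auto simp: carrier_hom_group hom_def Pi_def group.is_monoid monoid.m_closed)

lemma hom_group_group_hom:
  assumes "h \<in> carrier (hom_group G H)" "group G" "group H"
  shows "group_hom G H h"
  using assms by (simp add: group_hom_def group_hom_axioms_def carrier_hom_group)

lemma comm_group_hom_group:
  assumes "group G" "comm_group H"
  shows "comm_group (hom_group G H)"
proof -
  interpret G: group G by fact
  interpret H: comm_group H by fact
  show ?thesis
  proof (rule comm_groupI)
    fix g assume g: "g \<in> carrier (hom_group G H)"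
    then interpret g: group_hom G H g by (intro hom_group_group_hom) auto
    let ?g = "\<lambda>x\<in>carrier G. inv\<^bsub>H\<^esub> g x"
    have "?g \<in> carrier (hom_group G H)"
      by (rule hom_group_restrictI) (auto intro!: homI simp: H.inv_mult)
    moreover have "?g \<otimes>\<^bsub>hom_group G H\<^esub> g = \<one>\<^bsub>hom_group G H\<^esub>"
      by (auto simp: hom_group_def)
    ultimately show "\<exists>g'\<in>carrier (hom_group G H). g' \<otimes>\<^bsub>hom_group G H\<^esub> g = \<one>\<^bsub>hom_group G H\<^esub>"
      by blast
  qed (auto simp: hom_group_def hom_def Pi_def extensional_def fun_eq_iff H.m_ac)
qed

text \<open>This computes inverses and powers in a homomorphism group pointwise.\<close>

lemma hom_group_eval:
  assumes "group G" "comm_group H" "x \<in> carrier G"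
  shows "group_hom (hom_group G H) H (\<lambda>h. h x)"
proof -
  have "(\<lambda>h. h x) \<in> hom (hom_group G H) H"
    by (rule homI) (use assms(3) in \<open>auto simp: carrier_hom_group mult_hom_group hom_def\<close>)
  with assms show ?thesis
    by (simp add: group_hom_def group_hom_axioms_def comm_group_hom_group comm_group.axioms(2))
qed

lemma inv_hom_group:
  assumes "group G" "comm_group H" "x \<in> carrier G" "h \<in> carrier (hom_group G H)"
  shows "(inv\<^bsub>hom_group G H\<^esub> h) x = inv\<^bsub>H\<^esub> h x"
  using group_hom.hom_inv[OF hom_group_eval[OF assms(1-3)] assms(4)] .

section \<open>Tensor products of abelian groups\<close>

locale comm_group_pair = A: comm_group A + B: comm_group B
  for A :: "('a, 'm) monoid_scheme" and B :: "('b, 'n) monoid_scheme"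
begin

abbreviation "F \<equiv> free_Abelian_group (carrier A \<times> carrier B)"
abbreviation "N \<equiv> tensor_rel_group A B"
abbreviation "T \<equiv> tensor_group A B"
abbreviation "tens \<equiv> pure_tensor A B"

lemma normal_tensor_rels: "N \<lhd> F"
proof -
  have sub: "tensor_rels A B \<subseteq> carrier F"
    unfolding tensor_rels_def
    by (fastforce dest: subsetD[OF keys_diff])
  show ?thesis
    unfolding tensor_rel_group_def
    by (subst comm_group.normal_iff_subgroup[OF abelian_free_Abelian_group])
      (rule group.generate_is_subgroup[OF group_free_Abelian_group sub])
qed

sublocale F: comm_group F by (rule abelian_free_Abelian_group)
sublocale N: normal N F by (rule normal_tensor_rels)
sublocale T: comm_group T
  unfolding tensor_group_def by (rule F.abelian_FactGroup) (rule N.subgroup_axioms)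

lemma tens_closed [simp]: "a \<in> carrier A \<Longrightarrow> b \<in> carrier B \<Longrightarrow> tens a b \<in> carrier T"
  by (auto simp: pure_tensor_def tensor_group_def carrier_FactGroup)

lemma tens_coset_mult:
  assumes "a \<in> carrier A" "b \<in> carrier B" "a' \<in> carrier A" "b' \<in> carrier B"
  shows "tens a b \<otimes>\<^bsub>T\<^esub> tens a' b' = N #>\<^bsub>F\<^esub> (frag_of (a, b) + frag_of (a', b'))"
  using assms N.rcos_sum[of "frag_of (a, b)" "frag_of (a', b')"]
  by (simp add: pure_tensor_def tensor_group_def)

lemma tensor_coset_eqI:
  assumes "x - y \<in> tensor_rels A B" "x \<in> carrier F" "y \<in> carrier F"
  shows "N #>\<^bsub>F\<^esub> x = N #>\<^bsub>F\<^esub> y"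
proof -
  have "x \<otimes>\<^bsub>F\<^esub> inv\<^bsub>F\<^esub> y \<in> N"
    using assms by (simp add: tensor_rel_group_def generate.incl)
  then have "x \<in> N #>\<^bsub>F\<^esub> y"
    using assms(2,3) by (intro N.rcos_module_rev F.is_group)
  then show ?thesis
    using assms(3) by (metis F.repr_independence N.subgroup_axioms)
qed

lemma tens_mult_left:
  assumes "a \<in> carrier A" "a' \<in> carrier A" "b \<in> carrier B"
  shows "tens (a \<otimes>\<^bsub>A\<^esub> a') b = tens a b \<otimes>\<^bsub>T\<^esub> tens a' b"
proof -
  have "frag_of (a \<otimes>\<^bsub>A\<^esub> a', b) - (frag_of (a, b) + frag_of (a', b)) \<in> tensor_rels A B"
    using assms unfolding tensor_rels_def diff_diff_eq[symmetric] by blast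
  moreover have "frag_of (a, b) + frag_of (a', b) \<in> carrier F"
    using assms F.m_closed[of "frag_of (a,b)" "frag_of (a',b)"] by simp
  ultimately show ?thesis
    using assms by (simp add: tens_coset_mult) (simp add: pure_tensor_def tensor_coset_eqI)
qed

lemma tens_mult_right:
  assumes "a \<in> carrier A" "b \<in> carrier B" "b' \<in> carrier B"
  shows "tens a (b \<otimes>\<^bsub>B\<^esub> b') = tens a b \<otimes>\<^bsub>T\<^esub> tens a b'"
proof -
  have "frag_of (a, b \<otimes>\<^bsub>B\<^esub> b') - (frag_of (a, b) + frag_of (a, b')) \<in> tensor_rels A B"
    using assms unfolding tensor_rels_def diff_diff_eq[symmetric] by blast
  moreover have "frag_of (a, b) + frag_of (a, b') \<in> carrier F"
    using assms F.m_closed[of "frag_of (a,b)" "frag_of (a,b')"] by simp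
  ultimately show ?thesis
    using assms by (simp add: tens_coset_mult) (simp add: pure_tensor_def tensor_coset_eqI)
qed

lemma tens_hom_left: "b \<in> carrier B \<Longrightarrow> group_hom A T (\<lambda>a. tens a b)"
  by unfold_locales (auto simp: hom_def tens_mult_left)

lemma tens_hom_right: "a \<in> carrier A \<Longrightarrow> group_hom B T (tens a)"
  by unfold_locales (auto simp: hom_def tens_mult_right)

lemma tens_balanced:
  assumes "a \<in> carrier A" "b \<in> carrier B"
  shows "tens (a [^]\<^bsub>A\<^esub> (k::int)) b = tens a (b [^]\<^bsub>B\<^esub> k)"
  using assms group_hom.hom_int_pow[OF tens_hom_left[of b], of a k]
    group_hom.hom_int_pow[OF tens_hom_right[of a], of b k] by simp

text \<open>The case of a difference covers sums and inverses at once, because every element of a free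
  abelian group is built from its generators by differences.\<close>

lemma tensor_induct [consumes 1, case_names one diff tens]:
  assumes "t \<in> carrier T"
    and one: "P \<one>\<^bsub>T\<^esub>"
    and diff: "\<And>s t. s \<in> carrier T \<Longrightarrow> t \<in> carrier T \<Longrightarrow> P s \<Longrightarrow> P t \<Longrightarrow> P (s \<otimes>\<^bsub>T\<^esub> inv\<^bsub>T\<^esub> t)"
    and tens: "\<And>a b. a \<in> carrier A \<Longrightarrow> b \<in> carrier B \<Longrightarrow> P (tens a b)"
  shows "P t"
proof -
  from assms(1) obtain x where x: "Poly_Mapping.keys x \<subseteq> carrier A \<times> carrier B" and t: "t = N #>\<^bsub>F\<^esub> x"
    by (auto simp: tensor_group_def carrier_FactGroup)
  interpret c: group_hom F T "\<lambda>x. N #>\<^bsub>F\<^esub> x"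
    using N.r_coset_hom_Mod by unfold_locales (simp add: tensor_group_def)
  have "P (N #>\<^bsub>F\<^esub> x)"
    using x
  proof (induction rule: free_Abelian_group_induct[consumes 1])
    case 1
    then show ?case using one c.hom_one by simp
  next
    case (2 x y)
    have "N #>\<^bsub>F\<^esub> (x - y) = (N #>\<^bsub>F\<^esub> x) \<otimes>\<^bsub>T\<^esub> inv\<^bsub>T\<^esub> (N #>\<^bsub>F\<^esub> y)"
      using 2 c.hom_mult[of x "- y"] c.hom_inv[of y] by simp
    moreover have "(N #>\<^bsub>F\<^esub> x) \<in> carrier T" "(N #>\<^bsub>F\<^esub> y) \<in> carrier T"
      using 2 c.hom_closed by simp_all
    ultimately show ?case using 2 diff by simp
  next
    case (3 p)
    then show ?case using tens[of "fst p" "snd p"] by (auto simp: pure_tensor_def)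
  qed
  then show ?thesis by (simp add: t)
qed

lemma tensor_hom_eqI:
  assumes "group C" "g \<in> hom T C" "h \<in> hom T C"
    and "\<And>a b. a \<in> carrier A \<Longrightarrow> b \<in> carrier B \<Longrightarrow> g (tens a b) = h (tens a b)"
    and "t \<in> carrier T"
  shows "g t = h t"
proof -
  interpret C: group C by fact
  interpret g: group_hom T C g using assms by unfold_locales auto
  interpret h: group_hom T C h using assms by unfold_locales auto
  show ?thesis
    using assms(5) by (induction rule: tensor_induct) (auto simp: assms(4))
qed

text \<open>Existence: the homomorphism that extends \<open>\<beta>\<close> to the free abelian group kills the defining relations.
  Uniqueness: the pure tensors generate. Together they justify the definite description in the
  definition of the lift.\<close>

lemma tensor_lift:
  assumes "comm_group C"
    and closed: "\<And>a b. a \<in> carrier A \<Longrightarrow> b \<in> carrier B \<Longrightarrow> \<beta> a b \<in> carrier C"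
    and left: "\<And>a a' b. a \<in> carrier A \<Longrightarrow> a' \<in> carrier A \<Longrightarrow> b \<in> carrier B \<Longrightarrow>
        \<beta> (a \<otimes>\<^bsub>A\<^esub> a') b = \<beta> a b \<otimes>\<^bsub>C\<^esub> \<beta> a' b"
    and right: "\<And>a b b'. a \<in> carrier A \<Longrightarrow> b \<in> carrier B \<Longrightarrow> b' \<in> carrier B \<Longrightarrow>
        \<beta> a (b \<otimes>\<^bsub>B\<^esub> b') = \<beta> a b \<otimes>\<^bsub>C\<^esub> \<beta> a b'"
  shows "tensor_lift A B C \<beta> \<in> hom T C"
    and "\<And>a b. a \<in> carrier A \<Longrightarrow> b \<in> carrier B \<Longrightarrow> tensor_lift A B C \<beta> (tens a b) = \<beta> a b"
proof -
  interpret C: comm_group C by fact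
  obtain h where h: "h \<in> hom F C" and hf: "\<And>p. p \<in> carrier A \<times> carrier B \<Longrightarrow> h (frag_of p) = \<beta> (fst p) (snd p)"
  proof (rule C.free_Abelian_group_universal)
    show "(\<lambda>p. \<beta> (fst p) (snd p)) ` (carrier A \<times> carrier B) \<subseteq> carrier C"
      using closed by auto
  qed (rule that)
  interpret h: group_hom F C h using h by unfold_locales auto
  have hdiff: "h (x - y) = h x \<otimes>\<^bsub>C\<^esub> inv\<^bsub>C\<^esub> h y" if "x \<in> carrier F" "y \<in> carrier F" for x y
    using that h.hom_mult[of x "- y"] h.hom_inv[of y] by simp
  have diff_closed: "x - y \<in> carrier F" if "x \<in> carrier F" "y \<in> carrier F" for x y
    using that F.m_closed[of x "-y"] by simp
  have cancel: "x \<otimes>\<^bsub>C\<^esub> y \<otimes>\<^bsub>C\<^esub> inv\<^bsub>C\<^esub> x \<otimes>\<^bsub>C\<^esub> inv\<^bsub>C\<^esub> y = \<one>\<^bsub>C\<^esub>" if "x \<in> carrier C" "y \<in> carrier C" for x y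
    using that by (simp add: C.m_comm[of x y] C.m_assoc)
  have rel: "h (frag_of p - frag_of p' - frag_of p'') = \<one>\<^bsub>C\<^esub>"
    if "p \<in> carrier A \<times> carrier B" "p' \<in> carrier A \<times> carrier B" "p'' \<in> carrier A \<times> carrier B"
      and "\<beta> (fst p) (snd p) = \<beta> (fst p') (snd p') \<otimes>\<^bsub>C\<^esub> \<beta> (fst p'') (snd p'')" for p p' p''
  proof -
    have "h (frag_of p - frag_of p' - frag_of p'') = h (frag_of p) \<otimes>\<^bsub>C\<^esub> inv\<^bsub>C\<^esub> h (frag_of p') \<otimes>\<^bsub>C\<^esub> inv\<^bsub>C\<^esub> h (frag_of p'')"
      using that(1-3) by (simp only: hdiff diff_closed frag_of_in_free_Abelian_group)
    also have "\<dots> = \<one>\<^bsub>C\<^esub>"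
      using that cancel[OF closed closed] by (simp add: hf mem_Times_iff)
    finally show ?thesis .
  qed
  have "tensor_rels A B \<subseteq> kernel F C h"
  proof
    fix x assume "x \<in> tensor_rels A B"
    then show "x \<in> kernel F C h"
      unfolding tensor_rels_def
    proof (elim UnE CollectE exE conjE)
      fix a a' b assume x: "x = frag_of (a \<otimes>\<^bsub>A\<^esub> a', b) - frag_of (a, b) - frag_of (a', b)"
        and ab: "a \<in> carrier A" "a' \<in> carrier A" "b \<in> carrier B"
      have "h x = \<one>\<^bsub>C\<^esub>" unfolding x using ab by (intro rel) (auto simp: left)
      moreover have "x \<in> carrier F" unfolding x using ab by (intro diff_closed) simp_all
      ultimately show "x \<in> kernel F C h" by (simp add: kernel_def)
    next
      fix a b b' assume x: "x = frag_of (a, b \<otimes>\<^bsub>B\<^esub> b') - frag_of (a, b) - frag_of (a, b')"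
        and ab: "a \<in> carrier A" "b \<in> carrier B" "b' \<in> carrier B"
      have "h x = \<one>\<^bsub>C\<^esub>" unfolding x using ab by (intro rel) (auto simp: right)
      moreover have "x \<in> carrier F" unfolding x using ab by (intro diff_closed) simp_all
      ultimately show "x \<in> kernel F C h" by (simp add: kernel_def)
    qed
  qed
  then have "N \<subseteq> kernel F C h"
    unfolding tensor_rel_group_def by (intro F.generate_subgroup_incl h.subgroup_kernel)
  then obtain g where g: "g \<in> hom T C" "\<And>x. x \<in> carrier F \<Longrightarrow> g (N #>\<^bsub>F\<^esub> x) = h x"
    using h.FactGroup_universal_kernel[OF normal_tensor_rels] unfolding tensor_group_def by metis
  have gt: "g (tens a b) = \<beta> a b" if "a \<in> carrier A" "b \<in> carrier B" for a b
    using that g(2)[of "frag_of (a, b)"] hf[of "(a, b)"] by (simp add: pure_tensor_def)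
  let ?P = "\<lambda>h. h \<in> carrier (hom_group T C) \<and> (\<forall>a\<in>carrier A. \<forall>b\<in>carrier B. h (tens a b) = \<beta> a b)"
  have "?P (restrict g (carrier T))"
    using gt hom_group_restrictI[OF T.is_group g(1)] by simp
  moreover have "k = restrict g (carrier T)" if "?P k" for k
  proof (rule hom_group_eqI)
    show "k \<in> carrier (hom_group T C)" using that by simp
    show "restrict g (carrier T) \<in> carrier (hom_group T C)"
      by (rule hom_group_restrictI[OF T.is_group g(1)])
    fix t assume "t \<in> carrier T"
    with that show "k t = restrict g (carrier T) t"
      using tensor_hom_eqI[OF C.is_group _ g(1), of k t] gt by (auto simp: carrier_hom_group)
  qed
  ultimately have "?P (tensor_lift A B C \<beta>)"
    unfolding tensor_lift_def by (rule theI)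
  then show "tensor_lift A B C \<beta> \<in> hom T C"
    and "\<And>a b. a \<in> carrier A \<Longrightarrow> b \<in> carrier B \<Longrightarrow> tensor_lift A B C \<beta> (tens a b) = \<beta> a b"
    by (auto simp: carrier_hom_group)
qed

text \<open>If any two elements of the right factor are multiples of a common one, a difference of pure tensors
  can be rewritten over that common element and is again pure. Both the rationals and their quotient
  by the integers have this property, which makes every later computation one with pure tensors.\<close>

lemma tensor_pure:
  assumes cyc: "\<And>b b'. b \<in> carrier B \<Longrightarrow> b' \<in> carrier B \<Longrightarrow>
      \<exists>c\<in>carrier B. \<exists>(k::int) (l::int). b = c [^]\<^bsub>B\<^esub> k \<and> b' = c [^]\<^bsub>B\<^esub> l"
    and "t \<in> carrier T"
  shows "\<exists>a\<in>carrier A. \<exists>b\<in>carrier B. t = tens a b"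
  using assms(2)
proof (induction rule: tensor_induct)
  case one
  then show ?case
    using group_hom.hom_one[OF tens_hom_left[OF B.one_closed]] A.one_closed B.one_closed by metis
next
  case (diff s t)
  then obtain a b a' b' where ab: "a \<in> carrier A" "b \<in> carrier B" "s = tens a b"
      "a' \<in> carrier A" "b' \<in> carrier B" "t = tens a' b'"
    by blast
  obtain c k l where c: "c \<in> carrier B" and kl: "b = c [^]\<^bsub>B\<^esub> (k::int)" "b' = c [^]\<^bsub>B\<^esub> (l::int)"
    using cyc[OF ab(2) ab(5)] by blast
  interpret l: group_hom A T "\<lambda>a. tens a c" using c by (rule tens_hom_left)
  have "s \<otimes>\<^bsub>T\<^esub> inv\<^bsub>T\<^esub> t = tens (a [^]\<^bsub>A\<^esub> k \<otimes>\<^bsub>A\<^esub> inv\<^bsub>A\<^esub> (a' [^]\<^bsub>A\<^esub> l)) c"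
    using ab c by (simp add: kl tens_balanced)
  then show ?case using ab c by blast
next
  case (tens a b)
  then show ?case by blast
qed

end

lemma rat_common_multiple:
  fixes r s :: rat
  shows "\<exists>t. \<exists>(k::int) (l::int). r = of_int k * t \<and> s = of_int l * t"
proof -
  obtain a b c d where "r = of_int a / of_int b" "b > 0" "s = of_int c / of_int d" "d > 0"
    by (metis Fract_of_int_quotient Rat_cases)
  then have "r = of_int (a * d) * (1 / of_int (b * d)) \<and> s = of_int (c * b) * (1 / of_int (b * d))"
    by (simp add: field_simps)
  then show ?thesis by blast
qed

lemma rat_group_locally_cyclic:
  "\<exists>c\<in>carrier rat_group. \<exists>(k::int) (l::int). b = c [^]\<^bsub>rat_group\<^esub> k \<and> b' = c [^]\<^bsub>rat_group\<^esub> l"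
  using rat_common_multiple[of b b'] by simp

lemma QZ_locally_cyclic:
  assumes "b \<in> carrier QZ" "b' \<in> carrier QZ"
  shows "\<exists>c\<in>carrier QZ. \<exists>(k::int) (l::int). b = c [^]\<^bsub>QZ\<^esub> k \<and> b' = c [^]\<^bsub>QZ\<^esub> l"
proof -
  from assms obtain r s where "b = mod_Z r" "b' = mod_Z s" by (auto simp: carrier_QZ)
  moreover obtain t k l where "r = of_int (k::int) * t" "s = of_int (l::int) * t"
    using rat_common_multiple by blast
  ultimately have "b = mod_Z t [^]\<^bsub>QZ\<^esub> k \<and> b' = mod_Z t [^]\<^bsub>QZ\<^esub> l"
    by (simp add: mod_Z_int_pow)
  then show ?thesis using mod_Z_closed by blast
qed

section \<open>Homomorphisms to the integers\<close>

text \<open>Division with remainder by the least positive value: the remainder is again a value. If there is no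
  positive value, the homomorphism is zero.\<close>

lemma (in group) int_hom_generator:
  assumes "\<psi> \<in> hom G integer_group"
  shows "\<exists>e\<in>carrier G. \<forall>x\<in>carrier G. \<psi> e dvd \<psi> x"
proof -
  interpret p: group_hom G integer_group \<psi>
    using assms is_group by (simp add: group_hom_def group_hom_axioms_def)
  define P where "P d \<longleftrightarrow> d > 0 \<and> (\<exists>x\<in>carrier G. \<psi> x = int d)" for d :: nat
  show ?thesis
  proof (cases "\<exists>d. P d")
    case False
    have "\<psi> x = 0" if x: "x \<in> carrier G" for x
    proof (rule ccontr)
      assume "\<psi> x \<noteq> 0"
      then consider "\<psi> x > 0" | "\<psi> (inv x) > 0" using p.hom_inv[OF x] x by (simp, linarith)
      then have "P (nat \<bar>\<psi> x\<bar>)"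
        by cases (use x in \<open>auto simp: P_def intro: bexI[of _ x] bexI[of _ "inv x"]\<close>)
      with False show False by blast
    qed
    then show ?thesis by auto
  next
    case True
    define d where "d = (LEAST d. P d)"
    have "P d" and least: "\<And>k. P k \<Longrightarrow> d \<le> k"
      using True LeastI_ex[of P] Least_le[of P] by (auto simp: d_def)
    then obtain e where e: "e \<in> carrier G" "\<psi> e = int d" and "d > 0" by (auto simp: P_def)
    have "\<psi> e dvd \<psi> x" if x: "x \<in> carrier G" for x
    proof (rule ccontr)
      assume "\<not> \<psi> e dvd \<psi> x"
      then have "\<psi> x mod int d \<noteq> 0" using e(2) by (metis mod_0_imp_dvd)
      moreover have "\<psi> x mod int d \<ge> 0" using \<open>d > 0\<close> by simp
      ultimately have pos: "\<psi> x mod int d > 0" by linarith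
      have "\<psi> (x \<otimes> inv (e [^] (\<psi> x div int d))) = \<psi> x mod int d"
        using x e p.hom_int_pow[OF e(1)] by (simp add: minus_div_mult_eq_mod[symmetric])
      with pos x e have "P (nat (\<psi> x mod int d))"
        by (auto simp: P_def intro: bexI[of _ "x \<otimes> inv (e [^] (\<psi> x div int d))"])
      then have "d \<le> nat (\<psi> x mod int d)" by (rule least)
      with \<open>d > 0\<close> pos_mod_bound[of "int d" "\<psi> x"] show False by linarith
    qed
    with e show ?thesis by blast
  qed
qed

text \<open>The forms are killed one at a time. If \<open>\<rho>\<close> is a retraction for the first \<open>m\<close> of them, the next
  form takes on the range of \<open>\<rho>\<close> exactly the multiples of one value, attained at \<open>\<rho> e\<close>; subtracting
  from \<open>\<rho> x\<close> the right multiple of \<open>\<rho> e\<close> cancels the value of that form. Thus an intersection of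
  finitely many kernels of integral forms is a direct summand, in any abelian group.\<close>

lemma (in comm_group) int_homs_retraction:
  fixes m :: nat
  assumes "\<And>i. i < m \<Longrightarrow> a i \<in> hom G integer_group"
  shows "\<exists>\<rho>\<in>hom G G. (\<forall>x\<in>carrier G. \<forall>i<m. a i (\<rho> x) = 0) \<and>
      (\<forall>x\<in>carrier G. (\<forall>i<m. a i x = 0) \<longrightarrow> \<rho> x = x)"
  using assms
proof (induction m)
  case 0
  then show ?case by (intro bexI[of _ "\<lambda>x. x"]) (auto simp: hom_def)
next
  case (Suc m)
  then obtain \<rho> where \<rho>: "\<rho> \<in> hom G G" and zero: "\<And>x i. x \<in> carrier G \<Longrightarrow> i < m \<Longrightarrow> a i (\<rho> x) = 0"
    and fixd: "\<And>x. x \<in> carrier G \<Longrightarrow> \<forall>i<m. a i x = 0 \<Longrightarrow> \<rho> x = x"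
    by (metis less_SucI)
  interpret r: group_hom G G \<rho> using \<rho> by unfold_locales
  have a: "group_hom G integer_group (a i)" if "i \<le> m" for i
    using Suc.prems[of i] that is_group by (simp add: group_hom_def group_hom_axioms_def)
  define \<psi> where "\<psi> x = a m (\<rho> x)" for x
  have \<psi>: "\<psi> \<in> hom G integer_group"
    using Group.hom_compose[OF \<rho> group_hom.homh[OF a[of m]]] by (simp add: \<psi>_def[abs_def] comp_def)
  obtain e where e: "e \<in> carrier G" and dvd: "\<And>x. x \<in> carrier G \<Longrightarrow> \<psi> e dvd \<psi> x"
    using int_hom_generator[OF \<psi>] by blast
  define \<rho>' where "\<rho>' x = \<rho> x \<otimes> inv (\<rho> e [^] (\<psi> x div \<psi> e))" for x
  have closed: "\<rho> x \<in> carrier G" if "x \<in> carrier G" for x using that by simp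
  have "\<rho>' \<in> hom G G"
  proof (rule homI)
    fix x y assume xy: "x \<in> carrier G" "y \<in> carrier G"
    have "\<psi> (x \<otimes> y) div \<psi> e = \<psi> x div \<psi> e + \<psi> y div \<psi> e"
      using xy dvd hom_mult[OF \<psi>] by (simp add: div_plus_div_distrib_dvd_left)
    then show "\<rho>' (x \<otimes> y) = \<rho>' x \<otimes> \<rho>' y"
      using xy e by (simp add: \<rho>'_def int_pow_mult inv_mult m_ac)
  qed (use e in \<open>simp add: \<rho>'_def\<close>)
  moreover have "a i (\<rho>' x) = 0" if "i < Suc m" "x \<in> carrier G" for i x
  proof -
    interpret ai: group_hom G integer_group "a i" using a that by simp
    have "a i (\<rho>' x) = a i (\<rho> x) - (\<psi> x div \<psi> e) * a i (\<rho> e)"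
      using that e ai.hom_int_pow[OF closed[OF e]] by (simp add: \<rho>'_def)
    with that e zero dvd show ?thesis by (cases "i = m") (auto simp: \<psi>_def)
  qed
  moreover have "\<rho>' x = x" if "x \<in> carrier G" "\<forall>i<Suc m. a i x = 0" for x
  proof -
    have "\<rho> x = x" using fixd that by simp
    then show ?thesis using that e by (simp add: \<rho>'_def \<psi>_def)
  qed
  ultimately show ?case by blast
qed

section \<open>Cosets and representatives\<close>

lemma (in group) coset_eq_iff:
  assumes "subgroup N G" "x \<in> carrier G" "y \<in> carrier G"
  shows "N #> x = N #> y \<longleftrightarrow> x \<otimes> inv y \<in> N"
proof -
  have "N #> x = N #> y \<longleftrightarrow> x \<in> N #> y"
    using assms by (metis rcos_self repr_independence)
  also have "\<dots> \<longleftrightarrow> x \<otimes> inv y \<in> N"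
    using assms by (simp add: subgroup.rcos_module[OF assms(1) is_group])
  finally show ?thesis .
qed

lemma the_elem_image_const:
  assumes "x \<in> A" "\<And>y. y \<in> A \<Longrightarrow> h y = h x"
  shows "the_elem (h ` A) = h x"
proof -
  have "h ` A = {h x}" using assms by blast
  then show ?thesis by simp
qed

section \<open>The dual of a bilinear lattice\<close>

context bilinear_lattice
begin

abbreviation "D \<equiv> dual M"
abbreviation "V \<equiv> rationalization M"
abbreviation "tens \<equiv> pure_tensor M rat_group"
abbreviation "\<iota> x \<equiv> tens x 1"

sublocale D: comm_group D
  unfolding dual_def by (intro comm_group_hom_group is_group abelian_integer_group)

lemma dual_group_hom: "\<alpha> \<in> carrier D \<Longrightarrow> group_hom M integer_group \<alpha>"
  unfolding dual_def by (rule hom_group_group_hom) auto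

lemma dual_eval: "x \<in> carrier M \<Longrightarrow> group_hom D integer_group (\<lambda>\<alpha>. \<alpha> x)"
  unfolding dual_def by (intro hom_group_eval is_group abelian_integer_group)

lemma dual_apply_simps:
  assumes "\<alpha> \<in> carrier D" "x \<in> carrier M"
  shows "\<alpha> \<one> = 0" "y \<in> carrier M \<Longrightarrow> \<alpha> (x \<otimes> y) = \<alpha> x + \<alpha> y" "\<alpha> (inv x) = - \<alpha> x" "\<alpha> (x [^] (k::int)) = k * \<alpha> x"
proof -
  interpret a: group_hom M integer_group \<alpha> using assms(1) by (rule dual_group_hom)
  show "\<alpha> \<one> = 0" "y \<in> carrier M \<Longrightarrow> \<alpha> (x \<otimes> y) = \<alpha> x + \<alpha> y" "\<alpha> (inv x) = - \<alpha> x" "\<alpha> (x [^] k) = k * \<alpha> x"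
    using assms(2) a.hom_one a.hom_mult a.hom_inv a.hom_int_pow by simp_all
qed

lemma dual_simps:
  assumes "x \<in> carrier M" "\<alpha> \<in> carrier D"
  shows "\<one>\<^bsub>D\<^esub> x = 0" "\<beta> \<in> carrier D \<Longrightarrow> (\<alpha> \<otimes>\<^bsub>D\<^esub> \<beta>) x = \<alpha> x + \<beta> x" "(inv\<^bsub>D\<^esub> \<alpha>) x = - \<alpha> x" "(\<alpha> [^]\<^bsub>D\<^esub> (k::int)) x = k * \<alpha> x"
     "(\<alpha> [^]\<^bsub>D\<^esub> (n::nat)) x = int n * \<alpha> x"
proof -
  interpret a: group_hom D integer_group "\<lambda>\<alpha>. \<alpha> x" using assms(1) by (rule dual_eval)
  show "\<one>\<^bsub>D\<^esub> x = 0" "\<beta> \<in> carrier D \<Longrightarrow> (\<alpha> \<otimes>\<^bsub>D\<^esub> \<beta>) x = \<alpha> x + \<beta> x" "(inv\<^bsub>D\<^esub> \<alpha>) x = - \<alpha> x" "(\<alpha> [^]\<^bsub>D\<^esub> (k::int)) x = k * \<alpha> x"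
     "(\<alpha> [^]\<^bsub>D\<^esub> (n::nat)) x = int n * \<alpha> x"
    using assms(2) a.hom_one a.hom_mult a.hom_inv a.hom_int_pow a.hom_nat_pow by simp_all
qed

lemma dual_eqI:
  "\<alpha> \<in> carrier D \<Longrightarrow> \<beta> \<in> carrier D \<Longrightarrow> (\<And>x. x \<in> carrier M \<Longrightarrow> \<alpha> x = \<beta> x) \<Longrightarrow> \<alpha> = \<beta>"
  unfolding dual_def by (rule hom_group_eqI)

lemma dual_restrictI:
  assumes "\<And>x y. x \<in> carrier M \<Longrightarrow> y \<in> carrier M \<Longrightarrow> \<alpha> (x \<otimes> y) = \<alpha> x + \<alpha> y"
  shows "restrict \<alpha> (carrier M) \<in> carrier D"
  unfolding dual_def by (intro hom_group_restrictI is_group homI) (auto simp: assms)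

text \<open>The \<open>e i\<close> correspond to the free generators. The four properties are all that is used of freeness:
  generation, existence of forms with prescribed values on the basis, and separation of points by forms.\<close>

lemma basis:
  obtains n :: nat and e where "\<And>i. i < n \<Longrightarrow> e i \<in> carrier M"
    and "carrier M = generate M (e ` {..<n})"
    and "\<And>z. \<exists>\<alpha>\<in>carrier D. \<forall>i<n. \<alpha> (e i) = z i"
    and "\<And>x. x \<in> carrier M \<Longrightarrow> (\<And>\<alpha>. \<alpha> \<in> carrier D \<Longrightarrow> \<alpha> x = 0) \<Longrightarrow> x = \<one>"
proof -
  obtain n :: nat and \<phi> where \<phi>: "\<phi> \<in> iso M (free_Abelian_group {..<n})"
    using fin_gen_free by (auto simp: is_iso_def)
  define \<psi> where "\<psi> = inv_into (carrier M) \<phi>"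
  let ?F = "free_Abelian_group {..<n}"
  have \<psi>: "\<psi> \<in> iso ?F M" unfolding \<psi>_def by (rule iso_set_sym[OF \<phi>])
  interpret p: group_hom M ?F \<phi> using \<phi> by (simp add: group_hom_def group_hom_axioms_def iso_def)
  interpret q: group_hom ?F M \<psi> using \<psi> by (simp add: group_hom_def group_hom_axioms_def iso_def)
  have \<psi>\<phi>: "\<psi> (\<phi> x) = x" if "x \<in> carrier M" for x
    using \<phi> that by (simp add: \<psi>_def iso_def bij_betw_def)
  have \<phi>\<psi>: "\<phi> (\<psi> c) = c" if "c \<in> carrier ?F" for c
    using \<phi> that by (simp add: \<psi>_def iso_def bij_betw_def f_inv_into_f)
  let ?e = "\<lambda>i. \<psi> (frag_of i)"
  have e: "?e i \<in> carrier M" if "i < n" for i using that q.hom_closed by simp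
  have gen: "\<psi> c \<in> generate M (?e ` {..<n})" if "Poly_Mapping.keys c \<subseteq> {..<n}" for c
    using that
  proof (induction rule: free_Abelian_group_induct[consumes 1])
    case 1
    then show ?case using q.hom_one generate.one by simp
  next
    case (2 x y)
    then have "\<psi> (x - y) = \<psi> x \<otimes> inv (\<psi> y)"
      using q.hom_mult[of x "- y"] q.hom_inv[of y] by simp
    moreover have "inv (\<psi> y) \<in> generate M (?e ` {..<n})"
      using 2 e by (intro generate_m_inv_closed) auto
    ultimately show ?case using 2 by (simp add: generate.eng)
  next
    case (3 i)
    then show ?case by (auto intro: generate.incl)
  qed
  show thesis
  proof
    show "?e i \<in> carrier M" if "i < n" for i using that by (rule e)
    show "carrier M = generate M (?e ` {..<n})"
    proof
      show "carrier M \<subseteq> generate M (?e ` {..<n})"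
      proof
        fix x assume "x \<in> carrier M"
        then show "x \<in> generate M (?e ` {..<n})"
          using gen[of "\<phi> x"] \<psi>\<phi>[of x] p.hom_closed[of x] by simp
      qed
      show "generate M (?e ` {..<n}) \<subseteq> carrier M"
        by (rule generate_incl) (use e in auto)
    qed
    show "\<exists>\<alpha>\<in>carrier D. \<forall>i<n. \<alpha> (?e i) = z i" for z
    proof -
      obtain h where h: "h \<in> hom ?F integer_group" "\<And>i. i \<in> {..<n} \<Longrightarrow> h (frag_of i) = z i"
        by (rule comm_group.free_Abelian_group_universal[OF abelian_integer_group, of z "{..<n}"]) auto
      have "restrict (h \<circ> \<phi>) (carrier M) \<in> carrier D"
        unfolding dual_def by (intro hom_group_restrictI is_group Group.hom_compose[OF p.homh h(1)])
      moreover have "\<forall>i<n. restrict (h \<circ> \<phi>) (carrier M) (?e i) = z i"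
        using e \<phi>\<psi> h(2) by simp
      ultimately show ?thesis by blast
    qed
    show "x = \<one>" if x: "x \<in> carrier M" and zero: "\<And>\<alpha>. \<alpha> \<in> carrier D \<Longrightarrow> \<alpha> x = 0" for x
    proof -
      have "Poly_Mapping.lookup (\<phi> x) i = 0" for i
      proof -
        have "restrict (\<lambda>x. Poly_Mapping.lookup (\<phi> x) i) (carrier M) \<in> carrier D"
          by (rule dual_restrictI) (simp add: Poly_Mapping.lookup_add)
        from zero[OF this] x show ?thesis by simp
      qed
      then have "\<phi> x = 0" by (simp add: poly_mapping_eqI)
      then show ?thesis using \<psi>\<phi>[OF x] q.hom_one by simp
    qed
  qed
qed

lemma dual_separates:
  assumes "x \<in> carrier M" "\<And>\<alpha>. \<alpha> \<in> carrier D \<Longrightarrow> \<alpha> x = 0"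
  shows "x = \<one>"
  by (rule basis) (use assms in blast)

section \<open>The rational space and its forms\<close>

sublocale R: comm_group_pair M rat_group
  by (simp add: comm_group_pair_def comm_group_axioms)

lemma V_eq: "V = R.T" by (simp add: rationalization_def)

sublocale V: comm_group V unfolding V_eq by (rule R.T.comm_group_axioms)

lemma tens_closed [simp]: "x \<in> carrier M \<Longrightarrow> tens x r \<in> carrier V"
  by (simp add: V_eq)

lemma tens_mult:
  "x \<in> carrier M \<Longrightarrow> y \<in> carrier M \<Longrightarrow> tens (x \<otimes> y) r = tens x r \<otimes>\<^bsub>V\<^esub> tens y r"
  using R.tens_mult_left[of x y r] by (simp add: V_eq)

lemma tens_add: "x \<in> carrier M \<Longrightarrow> tens x (r + s) = tens x r \<otimes>\<^bsub>V\<^esub> tens x s"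
  using R.tens_mult_right[of x r s] by (simp add: V_eq)

lemma tens_hom: "group_hom M V (\<lambda>x. tens x r)"
  using R.tens_hom_left[of r] by (simp add: V_eq)

lemma tens_hom_rat: "x \<in> carrier M \<Longrightarrow> group_hom rat_group V (tens x)"
  using R.tens_hom_right[of x] by (simp add: V_eq)

lemma V_pure: "u \<in> carrier V \<Longrightarrow> \<exists>x\<in>carrier M. \<exists>r. u = tens x r"
  using R.tensor_pure[OF rat_group_locally_cyclic, of u] by (simp add: V_eq)

lemma tens_int_pow: "x \<in> carrier M \<Longrightarrow> tens (x [^] (k::int)) r = tens x (of_int k * r)"
  using R.tens_balanced[of x r k] by simp

lemma
  assumes "\<alpha> \<in> carrier D"
  shows dual_ext_hom: "group_hom V rat_group (dual_ext M \<alpha>)"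
    and dual_ext_tens: "x \<in> carrier M \<Longrightarrow> dual_ext M \<alpha> (tens x r) = r * of_int (\<alpha> x)"
proof -
  note lift = R.tensor_lift[where C = rat_group and \<beta> = "\<lambda>x r. r * of_int (\<alpha> x)"]
  have "dual_ext M \<alpha> \<in> hom V rat_group"
    unfolding dual_ext_def V_eq by (rule lift) (use assms in \<open>auto simp: dual_apply_simps algebra_simps\<close>)
  then show "group_hom V rat_group (dual_ext M \<alpha>)"
    by (simp add: group_hom_def group_hom_axioms_def V.is_group)
  show "dual_ext M \<alpha> (tens x r) = r * of_int (\<alpha> x)" if "x \<in> carrier M"
    unfolding dual_ext_def by (rule lift) (use assms that in \<open>auto simp: dual_apply_simps algebra_simps\<close>)
qed

lemma dual_ext_mult:
  "\<alpha> \<in> carrier D \<Longrightarrow> u \<in> carrier V \<Longrightarrow> v \<in> carrier V \<Longrightarrow>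
    dual_ext M \<alpha> (u \<otimes>\<^bsub>V\<^esub> v) = dual_ext M \<alpha> u + dual_ext M \<alpha> v"
  using group_hom.hom_mult[OF dual_ext_hom] by simp

lemma dual_ext_hom_dual:
  assumes "u \<in> carrier V"
  shows "group_hom D rat_group (\<lambda>\<alpha>. dual_ext M \<alpha> u)"
proof -
  obtain x r where u: "x \<in> carrier M" "u = tens x r" using V_pure[OF assms] by blast
  have "(\<lambda>\<alpha>. dual_ext M \<alpha> u) \<in> hom D rat_group"
    by (rule homI) (use u in \<open>auto simp: dual_ext_tens dual_simps algebra_simps\<close>)
  then show ?thesis
    by (simp add: group_hom_def group_hom_axioms_def D.is_group)
qed

lemma dual_ext_dual_simps:
  assumes "u \<in> carrier V" "\<alpha> \<in> carrier D"
  shows "\<beta> \<in> carrier D \<Longrightarrow> dual_ext M (\<alpha> \<otimes>\<^bsub>D\<^esub> \<beta>) u = dual_ext M \<alpha> u + dual_ext M \<beta> u"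
    "dual_ext M (inv\<^bsub>D\<^esub> \<alpha>) u = - dual_ext M \<alpha> u"
    "dual_ext M (\<alpha> [^]\<^bsub>D\<^esub> (k::int)) u = of_int k * dual_ext M \<alpha> u"
    "dual_ext M (\<alpha> [^]\<^bsub>D\<^esub> (n::nat)) u = of_nat n * dual_ext M \<alpha> u"
    "dual_ext M \<one>\<^bsub>D\<^esub> u = 0"
proof -
  interpret a: group_hom D rat_group "\<lambda>\<alpha>. dual_ext M \<alpha> u" using assms(1) by (rule dual_ext_hom_dual)
  show "\<beta> \<in> carrier D \<Longrightarrow> dual_ext M (\<alpha> \<otimes>\<^bsub>D\<^esub> \<beta>) u = dual_ext M \<alpha> u + dual_ext M \<beta> u"
    "dual_ext M (inv\<^bsub>D\<^esub> \<alpha>) u = - dual_ext M \<alpha> u"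
    "dual_ext M (\<alpha> [^]\<^bsub>D\<^esub> (k::int)) u = of_int k * dual_ext M \<alpha> u"
    "dual_ext M (\<alpha> [^]\<^bsub>D\<^esub> (n::nat)) u = of_nat n * dual_ext M \<alpha> u"
    "dual_ext M \<one>\<^bsub>D\<^esub> u = 0"
    using assms(2) a.hom_one a.hom_mult a.hom_inv a.hom_int_pow a.hom_nat_pow by simp_all
qed

text \<open>A form \<open>\<alpha>\<close> takes the value \<open>r \<alpha>(x)\<close> on \<open>x \<otimes> r\<close>, and the forms separate the points of the lattice.\<close>

lemma tens_eq_one:
  assumes "x \<in> carrier M" "r \<noteq> 0" "tens x r = \<one>\<^bsub>V\<^esub>"
  shows "x = \<one>"
proof (rule dual_separates)
  fix \<alpha> assume a: "\<alpha> \<in> carrier D"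
  show "\<alpha> x = 0"
    using group_hom.hom_one[OF dual_ext_hom[OF a]] dual_ext_tens[OF a assms(1), of r] assms by simp
qed fact

lemma f_add_right: "x \<in> carrier M \<Longrightarrow> y \<in> carrier M \<Longrightarrow> z \<in> carrier M \<Longrightarrow> f x (y \<otimes> z) = f x y + f x z"
  using f_sym f_add by simp

lemma adj_closed [simp]: "x \<in> carrier M \<Longrightarrow> adj M f x \<in> carrier D"
  unfolding adj_def by (rule dual_restrictI) (simp add: f_add_right)

lemma adj_apply: "y \<in> carrier M \<Longrightarrow> adj M f x y = f x y"
  by (simp add: adj_def)

lemma adj_hom: "group_hom M D (adj M f)"
proof -
  have "adj M f \<in> hom M D"
    by (intro homI dual_eqI) (auto simp: dual_simps adj_apply f_add)
  then show ?thesis by unfold_locales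
qed

lemma
  assumes "v \<in> carrier V"
  shows form_ext_hom_left: "group_hom V rat_group (\<lambda>u. form_ext M f u v)"
    and form_ext_tens_left: "x \<in> carrier M \<Longrightarrow> form_ext M f (tens x r) v = r * dual_ext M (adj M f x) v"
proof -
  note lift = R.tensor_lift[where C = rat_group and \<beta> = "\<lambda>x r. r * dual_ext M (adj M f x) v"]
  have ad: "dual_ext M (adj M f (x \<otimes> y)) v = dual_ext M (adj M f x) v + dual_ext M (adj M f y) v"
    if "x \<in> carrier M" "y \<in> carrier M" for x y
    using that assms group_hom.hom_mult[OF adj_hom] by (simp add: dual_ext_dual_simps)
  have "(\<lambda>u. form_ext M f u v) \<in> hom V rat_group"
    unfolding form_ext_def V_eq by (rule lift) (auto simp: ad algebra_simps)
  then show "group_hom V rat_group (\<lambda>u. form_ext M f u v)"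
    by (simp add: group_hom_def group_hom_axioms_def V.is_group)
  show "form_ext M f (tens x r) v = r * dual_ext M (adj M f x) v" if "x \<in> carrier M"
    unfolding form_ext_def by (rule lift) (use that in \<open>auto simp: ad algebra_simps\<close>)
qed

lemma form_ext_tens:
  "x \<in> carrier M \<Longrightarrow> y \<in> carrier M \<Longrightarrow> form_ext M f (tens x r) (tens y s) = r * s * of_int (f x y)"
  by (simp add: form_ext_tens_left dual_ext_tens adj_apply)

lemma form_ext_sym:
  assumes "u \<in> carrier V" "v \<in> carrier V"
  shows "form_ext M f u v = form_ext M f v u"
proof -
  obtain x r y s where "x \<in> carrier M" "u = tens x r" "y \<in> carrier M" "v = tens y s"
    using V_pure assms by metis
  then show ?thesis using f_sym by (simp add: form_ext_tens)
qed

lemma form_ext_mult_left: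
  "u \<in> carrier V \<Longrightarrow> v \<in> carrier V \<Longrightarrow> w \<in> carrier V \<Longrightarrow>
    form_ext M f (u \<otimes>\<^bsub>V\<^esub> v) w = form_ext M f u w + form_ext M f v w"
  using group_hom.hom_mult[OF form_ext_hom_left] by simp

lemma form_ext_inv_left:
  "u \<in> carrier V \<Longrightarrow> w \<in> carrier V \<Longrightarrow> form_ext M f (inv\<^bsub>V\<^esub> u) w = - form_ext M f u w"
  using group_hom.hom_inv[OF form_ext_hom_left] by simp

lemma form_ext_mult_right:
  "u \<in> carrier V \<Longrightarrow> v \<in> carrier V \<Longrightarrow> w \<in> carrier V \<Longrightarrow>
    form_ext M f w (u \<otimes>\<^bsub>V\<^esub> v) = form_ext M f w u + form_ext M f w v"
  by (simp add: form_ext_sym[of w] form_ext_mult_left)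

lemma form_ext_lattice: "x \<in> carrier M \<Longrightarrow> v \<in> carrier V \<Longrightarrow> form_ext M f (\<iota> x) v = dual_ext M (adj M f x) v"
  by (simp add: form_ext_tens_left)

section \<open>The dual lattice\<close>

abbreviation "Msharp \<equiv> dual_lattice M f"
abbreviation "L \<equiv> lattice_image M"

lemma mem_Msharp_iff: "u \<in> Msharp \<longleftrightarrow> u \<in> carrier V \<and> (\<forall>x\<in>carrier M. form_ext M f (\<iota> x) u \<in> \<int>)"
  by (auto simp: dual_lattice_def lattice_image_def form_ext_sym)

lemma Msharp_V: "u \<in> Msharp \<Longrightarrow> u \<in> carrier V" by (simp add: mem_Msharp_iff)

lemma Msharp_subgroup: "subgroup Msharp V"
proof (rule V.subgroupI)
  show "Msharp \<noteq> {}"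
    using group_hom.hom_one[OF form_ext_hom_left] by (auto simp: dual_lattice_def lattice_image_def intro!: exI[of _ "\<one>\<^bsub>V\<^esub>"])
qed (auto simp: dual_lattice_def lattice_image_def form_ext_inv_left form_ext_mult_left)

lemma L_Msharp: "L \<subseteq> Msharp"
  by (auto simp: mem_Msharp_iff lattice_image_def form_ext_tens)

lemma L_subgroup: "subgroup L V"
  using group_hom.img_is_subgroup[OF tens_hom[of 1]] by (simp add: lattice_image_def)

text \<open>The form \<open>f(u, -)\<close>; for \<open>u\<close> in the dual lattice its values are integral, and the floor
  only changes their type.\<close>

definition flat :: "('a \<times> rat \<Rightarrow>\<^sub>0 int) set \<Rightarrow> 'a \<Rightarrow> int" where
  "flat u = (\<lambda>x\<in>carrier M. \<lfloor>form_ext M f u (\<iota> x)\<rfloor>)"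

lemma flat_apply:
  assumes "u \<in> Msharp" "x \<in> carrier M"
  shows "of_int (flat u x) = form_ext M f u (\<iota> x)"
  using assms by (auto simp: flat_def mem_Msharp_iff form_ext_sym[of u] elim!: Ints_cases dest!: bspec)

lemma flat_closed: "u \<in> Msharp \<Longrightarrow> flat u \<in> carrier D"
  unfolding flat_def
proof (rule dual_restrictI)
  fix x y assume u: "u \<in> Msharp" and xy: "x \<in> carrier M" "y \<in> carrier M"
  have "form_ext M f u (\<iota> x) \<in> \<int>" "form_ext M f u (\<iota> y) \<in> \<int>"
    using u xy by (auto simp: mem_Msharp_iff form_ext_sym[of u])
  moreover have "form_ext M f u (\<iota> (x \<otimes> y)) = form_ext M f u (\<iota> x) + form_ext M f u (\<iota> y)"
    using u xy by (simp add: tens_mult form_ext_mult_right Msharp_V)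
  ultimately show "\<lfloor>form_ext M f u (\<iota> (x \<otimes> y))\<rfloor> = \<lfloor>form_ext M f u (\<iota> x)\<rfloor> + \<lfloor>form_ext M f u (\<iota> y)\<rfloor>"
    by (auto elim!: Ints_cases)
qed

lemma dual_ext_flat:
  assumes "u \<in> Msharp" "v \<in> carrier V"
  shows "dual_ext M (flat u) v = form_ext M f u v"
proof -
  obtain y s where y: "y \<in> carrier M" "v = tens y s" using V_pure assms by metis
  obtain x r where x: "x \<in> carrier M" "u = tens x r" using V_pure assms Msharp_V by metis
  show ?thesis
    using y x assms(1) flat_apply[OF assms(1) y(1)] flat_closed[OF assms(1)]
    by (simp add: dual_ext_tens form_ext_tens)
qed

lemma flat_mult:
  assumes "u \<in> Msharp" "v \<in> Msharp"
  shows "flat (u \<otimes>\<^bsub>V\<^esub> v) = flat u \<otimes>\<^bsub>D\<^esub> flat v"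
proof -
  have uv: "u \<otimes>\<^bsub>V\<^esub> v \<in> Msharp" using assms Msharp_subgroup by (simp add: subgroup.m_closed)
  show ?thesis
  proof (rule dual_eqI)
    fix x assume x: "x \<in> carrier M"
    have "(of_int (flat (u \<otimes>\<^bsub>V\<^esub> v) x) :: rat) = of_int ((flat u \<otimes>\<^bsub>D\<^esub> flat v) x)"
      using x uv assms by (simp add: dual_simps flat_closed flat_apply form_ext_mult_left Msharp_V)
    then show "flat (u \<otimes>\<^bsub>V\<^esub> v) x = (flat u \<otimes>\<^bsub>D\<^esub> flat v) x" by simp
  qed (use assms uv flat_closed in auto)
qed

section \<open>Duality with Q/Z\<close>

text \<open>The induction is on the number \<open>m\<close> of basis vectors on which the members of \<open>S\<close> may be nonzero. The
  forms in \<open>S\<close> that vanish on the last of them make up a smaller group \<open>S'\<close>, for which a vector \<open>u\<close>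
  exists. Modulo \<open>S'\<close>, \<open>S\<close> is generated by one form \<open>\<alpha>0\<close>, and adding a rational multiple of the last
  basis vector to \<open>u\<close> corrects the value on \<open>\<alpha>0\<close> without changing those on \<open>S'\<close>.\<close>

lemma QZ_hom_is_evaluation_aux:
  fixes m n :: nat
  assumes e: "\<And>i. i < n \<Longrightarrow> e i \<in> carrier M" and gen: "carrier M = generate M (e ` {..<n})"
    and "subgroup S D" "h \<in> hom (D\<lparr>carrier := S\<rparr>) QZ" "m \<le> n"
    and "\<And>\<alpha> i. \<alpha> \<in> S \<Longrightarrow> m \<le> i \<Longrightarrow> i < n \<Longrightarrow> \<alpha> (e i) = 0"
  shows "\<exists>u\<in>carrier V. \<forall>\<alpha>\<in>S. h \<alpha> = mod_Z (dual_ext M \<alpha> u)"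
  using assms(3-)
proof (induction m arbitrary: S h)
  case 0
  interpret h: group_hom "D\<lparr>carrier := S\<rparr>" QZ h
    using 0 by (simp add: group_hom_def group_hom_axioms_def D.subgroup_imp_group)
  have "\<alpha> = \<one>\<^bsub>D\<^esub>" if a: "\<alpha> \<in> S" for \<alpha>
  proof (rule dual_eqI)
    show aD: "\<alpha> \<in> carrier D" using a 0 subgroup.mem_carrier by metis
    fix x assume "x \<in> carrier M"
    then have "x \<in> generate M (e ` {..<n})" using gen by simp
    then have "x \<in> carrier M \<and> \<alpha> x = 0"
      by induction (use a 0 e aD dual_apply_simps(1)[OF aD one_closed] in \<open>auto simp: dual_apply_simps\<close>)
    then show "\<alpha> x = \<one>\<^bsub>D\<^esub> x" using aD by (simp add: dual_simps)
  qed simp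
  then have "h \<alpha> = mod_Z (dual_ext M \<alpha> \<one>\<^bsub>V\<^esub>)" if "\<alpha> \<in> S" for \<alpha>
  proof -
    have "\<alpha> = \<one>\<^bsub>D\<^esub>" using that by fact
    moreover have "h \<one>\<^bsub>D\<^esub> = \<one>\<^bsub>QZ\<^esub>" using h.hom_one by simp
    ultimately show ?thesis
      using group_hom.hom_one[OF dual_ext_hom_dual[OF V.one_closed]] by (simp only: rat_group_simps mod_Z_0)
  qed
  then show ?case by blast
next
  case (Suc m)
  note S = \<open>subgroup S D\<close>
  have SD: "\<alpha> \<in> carrier D" if "\<alpha> \<in> S" for \<alpha> using S that by (rule subgroup.mem_carrier)
  let ?DS = "D\<lparr>carrier := S\<rparr>"
  interpret S: group ?DS using S by (rule D.subgroup_imp_group)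
  interpret h: group_hom ?DS QZ h
    using Suc by (simp add: group_hom_def group_hom_axioms_def S.is_group)
  have em: "e m \<in> carrier M" using e Suc by simp
  define S' where "S' = {\<alpha> \<in> S. \<alpha> (e m) = 0}"
  have S': "subgroup S' D"
  proof (rule D.subgroupI)
    show "S' \<noteq> {}"
      using subgroup.one_closed[OF S] dual_simps(1)[OF em D.one_closed] by (auto simp: S'_def)
  qed (use S em SD in \<open>auto simp: S'_def dual_simps subgroup.m_inv_closed subgroup.m_closed\<close>)
  have "\<exists>u\<in>carrier V. \<forall>\<alpha>\<in>S'. h \<alpha> = mod_Z (dual_ext M \<alpha> u)"
  proof (rule Suc.IH[OF S'])
    show "h \<in> hom (D\<lparr>carrier := S'\<rparr>) QZ"
      using h.homh by (auto simp: hom_def S'_def)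
    show "m \<le> n" using Suc by simp
    show "\<alpha> (e i) = 0" if "\<alpha> \<in> S'" "m \<le> i" "i < n" for \<alpha> i
      using that Suc.prems(4)[of \<alpha> i] by (cases "i = m") (auto simp: S'_def)
  qed
  then obtain u where u: "u \<in> carrier V" and hu: "\<And>\<alpha>. \<alpha> \<in> S' \<Longrightarrow> h \<alpha> = mod_Z (dual_ext M \<alpha> u)"
    by blast
  have "(\<lambda>\<alpha>. \<alpha> (e m)) \<in> hom ?DS integer_group"
    by (rule homI) (use em SD in \<open>auto simp: dual_simps\<close>)
  from S.int_hom_generator[OF this] obtain \<alpha>0 where \<alpha>0: "\<alpha>0 \<in> S"
    and dvd: "\<And>\<alpha>. \<alpha> \<in> S \<Longrightarrow> \<alpha>0 (e m) dvd \<alpha> (e m)" by auto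
  define d where "d = \<alpha>0 (e m)"
  show ?case
  proof (cases "d = 0")
    case True
    then have "S' = S" using dvd by (auto simp: S'_def d_def)
    then show ?thesis using u hu by blast
  next
    case False
    obtain r0 where r0: "h \<alpha>0 = mod_Z r0" using h.hom_closed[of \<alpha>0] \<alpha>0 by (auto simp: carrier_QZ)
    \<comment> \<open>solves \<open>\<alpha>0(u) + d t = r0\<close>, where \<open>d\<close> is the value of \<open>\<alpha>0\<close> on the basis vector\<close>
    define t where "t = (r0 - dual_ext M \<alpha>0 u) / of_int d"
    define u' where "u' = u \<otimes>\<^bsub>V\<^esub> tens (e m) t"
    have u': "u' \<in> carrier V" using u em by (simp add: u'_def)
    have ext: "dual_ext M \<alpha> u' = dual_ext M \<alpha> u + t * of_int (\<alpha> (e m))" if "\<alpha> \<in> carrier D" for \<alpha>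
      using that u em by (simp add: u'_def dual_ext_mult dual_ext_tens)
    have "h \<alpha> = mod_Z (dual_ext M \<alpha> u')" if a: "\<alpha> \<in> S" for \<alpha>
    proof -
      obtain k where k: "\<alpha> (e m) = d * k" using dvd[OF a] by (auto simp: d_def)
      have pow: "\<alpha>0 [^]\<^bsub>D\<^esub> k = \<alpha>0 [^]\<^bsub>?DS\<^esub> k"
        using D.int_pow_consistent[OF S \<alpha>0] .
      have powS: "\<alpha>0 [^]\<^bsub>D\<^esub> k \<in> S" unfolding pow using \<alpha>0 S.int_pow_closed[of \<alpha>0 k] by simp
      define \<beta> where "\<beta> = \<alpha> \<otimes>\<^bsub>D\<^esub> inv\<^bsub>D\<^esub> (\<alpha>0 [^]\<^bsub>D\<^esub> k)"
      have \<beta>: "\<beta> \<in> S'"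
        using a powS em SD[OF a] SD[OF \<alpha>0] k
        by (simp add: S'_def \<beta>_def subgroup.m_closed[OF S] subgroup.m_inv_closed[OF S] dual_simps d_def)
      have \<beta>S: "\<beta> \<in> S" using \<beta> by (simp add: S'_def)
      have a_eq: "\<alpha> = \<beta> \<otimes>\<^bsub>D\<^esub> \<alpha>0 [^]\<^bsub>D\<^esub> k"
        using SD[OF a] SD[OF \<alpha>0] by (simp add: \<beta>_def D.m_assoc)
      have "h \<alpha> = h \<beta> \<otimes>\<^bsub>QZ\<^esub> h (\<alpha>0 [^]\<^bsub>D\<^esub> k)"
        unfolding a_eq using h.hom_mult[of \<beta> "\<alpha>0 [^]\<^bsub>D\<^esub> k"] \<beta>S powS by simp
      also have "h (\<alpha>0 [^]\<^bsub>D\<^esub> k) = mod_Z (of_int k * r0)"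
        unfolding pow using h.hom_int_pow[of \<alpha>0 k] \<alpha>0 by (simp add: r0 mod_Z_int_pow)
      also have "h \<beta> \<otimes>\<^bsub>QZ\<^esub> mod_Z (of_int k * r0) = mod_Z (dual_ext M \<beta> u + of_int k * r0)"
        by (simp add: hu[OF \<beta>] mod_Z_mult)
      also have "dual_ext M \<beta> u + of_int k * r0 = dual_ext M \<alpha> u'"
        using False SD[OF a] SD[OF \<alpha>0] u
        by (simp add: ext k \<beta>_def dual_ext_dual_simps t_def field_simps)
      finally show ?thesis .
    qed
    with u' show ?thesis by blast
  qed
qed

text \<open>This is the injectivity of \<open>Q/Z\<close> (the homomorphism is only given on a subgroup) together with the
  reflexivity of a free group of finite rank.\<close>

lemma QZ_hom_is_evaluation:
  assumes "subgroup S D" "h \<in> hom (D\<lparr>carrier := S\<rparr>) QZ"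
  shows "\<exists>u\<in>carrier V. \<forall>\<alpha>\<in>S. h \<alpha> = mod_Z (dual_ext M \<alpha> u)"
proof -
  obtain n :: nat and e where "\<And>i. i < n \<Longrightarrow> e i \<in> carrier M" "carrier M = generate M (e ` {..<n})"
    by (rule basis) blast
  from QZ_hom_is_evaluation_aux[OF this assms order.refl] show ?thesis by simp
qed

lemma adj_image_subgroup: "subgroup (adj M f ` carrier M) D"
  using group_hom.img_is_subgroup[OF adj_hom] .

text \<open>If \<open>\<alpha>\<close> is not of the form \<open>f(x, -)\<close>, its class in the cokernel is nonzero, so the subgroup \<open>S\<close>
  generated by \<open>f^(M)\<close> and \<open>\<alpha>\<close> has a homomorphism to \<open>Q/Z\<close> that kills \<open>f^(M)\<close> but not \<open>\<alpha>\<close>. It is the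
  evaluation at a vector \<open>u\<close>: killing \<open>f^(M)\<close> means that \<open>u\<close> lies in the dual lattice, and the value
  on \<open>\<alpha>\<close> says that \<open>\<alpha>(u)\<close> is not integral.\<close>

lemma integral_on_dual_lattice_imp_adj:
  assumes "\<alpha> \<in> carrier D" "\<And>u. u \<in> Msharp \<Longrightarrow> dual_ext M \<alpha> u \<in> \<int>"
  shows "\<alpha> \<in> adj M f ` carrier M"
proof (rule ccontr)
  assume notin: "\<alpha> \<notin> adj M f ` carrier M"
  let ?A = "adj M f ` carrier M"
  note A = adj_image_subgroup
  interpret A: subgroup ?A D by (rule A)
  note \<alpha> = assms(1)
  have AD: "\<kappa> \<in> carrier D" if "\<kappa> \<in> ?A" for \<kappa> using that by auto
  \<comment> \<open>the annihilator of the class of \<open>\<alpha>\<close> in the cokernel\<close>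
  define P where "P = {k::int. \<alpha> [^]\<^bsub>D\<^esub> k \<in> ?A}"
  have P: "subgroup P integer_group"
    by (rule group.subgroupI)
      (auto simp: P_def D.int_pow_neg D.int_pow_mult \<alpha> intro!: exI[of _ 0])
  have "(\<lambda>k. k) \<in> hom (integer_group\<lparr>carrier := P\<rparr>) integer_group"
    by (simp add: hom_def)
  then obtain d where d: "d \<in> P" "\<And>k. k \<in> P \<Longrightarrow> d dvd k"
    using group.int_hom_generator[OF group.subgroup_imp_group[OF group_integer_group P], of "\<lambda>k. k"] by auto
  \<comment> \<open>the value prescribed on \<open>\<alpha>\<close>: of the exact order of its class, or of order 2 if that order is infinite\<close>
  define t :: rat where "t = (if d = 0 then 1 / 2 else 1 / of_int d)"
  have tP: "of_int k * t \<in> \<int>" if "k \<in> P" for k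
    using d(2)[OF that] by (auto simp: t_def)
  have "\<bar>d\<bar> \<noteq> 1"
  proof
    assume "\<bar>d\<bar> = 1"
    then have "1 \<in> P" using d(1) group.subgroup_int_pow_closed[OF group_integer_group P, of d d]
      by (auto simp: abs_if split: if_splits)
    then show False using notin \<alpha> by (simp add: P_def)
  qed
  have t: "t \<notin> \<int>"
  proof
    assume "t \<in> \<int>"
    then obtain z where z: "t = of_int z" by (rule Ints_cases)
    define d' where "d' = (if d = 0 then 2 else d)"
    have "of_int (d' * z) = (1 :: rat)"
      unfolding of_int_mult z[symmetric] by (auto simp: t_def d'_def)
    then have "d' * z = 1" by linarith
    then have "\<bar>d'\<bar> = 1" by (simp add: zmult_eq_1_iff) linarith
    with \<open>\<bar>d\<bar> \<noteq> 1\<close> show False by (auto simp: d'_def split: if_splits)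
  qed
  define S where "S = {\<kappa> \<otimes>\<^bsub>D\<^esub> \<alpha> [^]\<^bsub>D\<^esub> k | \<kappa> (k::int). \<kappa> \<in> ?A}"
  have SI: "\<kappa> \<otimes>\<^bsub>D\<^esub> \<alpha> [^]\<^bsub>D\<^esub> k \<in> S" if "\<kappa> \<in> ?A" for \<kappa> and k :: int
    using that by (auto simp: S_def)
  have S_mult: "(\<kappa> \<otimes>\<^bsub>D\<^esub> \<alpha> [^]\<^bsub>D\<^esub> k) \<otimes>\<^bsub>D\<^esub> (\<mu> \<otimes>\<^bsub>D\<^esub> \<alpha> [^]\<^bsub>D\<^esub> l) = (\<kappa> \<otimes>\<^bsub>D\<^esub> \<mu>) \<otimes>\<^bsub>D\<^esub> \<alpha> [^]\<^bsub>D\<^esub> (k + l)"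
    if "\<kappa> \<in> ?A" "\<mu> \<in> ?A" for \<kappa> \<mu> and k l :: int
    using AD[OF that(1)] AD[OF that(2)] \<alpha> by (simp add: D.int_pow_mult D.m_ac)
  have S: "subgroup S D"
  proof (rule D.subgroupI)
    show "S \<subseteq> carrier D" using \<alpha> AD by (auto simp: S_def)
    show "S \<noteq> {}" using SI[OF A.one_closed] by blast
    show "inv\<^bsub>D\<^esub> s \<in> S" if sS: "s \<in> S" for s
    proof -
      obtain \<kappa> k where s: "\<kappa> \<in> ?A" "s = \<kappa> \<otimes>\<^bsub>D\<^esub> \<alpha> [^]\<^bsub>D\<^esub> (k::int)" using sS unfolding S_def by blast
      have "inv\<^bsub>D\<^esub> s = inv\<^bsub>D\<^esub> \<kappa> \<otimes>\<^bsub>D\<^esub> \<alpha> [^]\<^bsub>D\<^esub> (- k)"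
        using AD[OF s(1)] \<alpha> by (simp add: s(2) D.inv_mult D.int_pow_neg)
      then show ?thesis using SI A.m_inv_closed s(1) by simp
    qed
    show "s \<otimes>\<^bsub>D\<^esub> s' \<in> S" if sS: "s \<in> S" "s' \<in> S" for s s'
    proof -
      obtain \<kappa> k \<mu> l where "\<kappa> \<in> ?A" "s = \<kappa> \<otimes>\<^bsub>D\<^esub> \<alpha> [^]\<^bsub>D\<^esub> (k::int)" "\<mu> \<in> ?A" "s' = \<mu> \<otimes>\<^bsub>D\<^esub> \<alpha> [^]\<^bsub>D\<^esub> (l::int)"
        using sS unfolding S_def by blast
      then show ?thesis using S_mult[of \<kappa> \<mu> k l] SI[OF A.m_closed, of \<kappa> \<mu> "k + l"] by simp
    qed
  qed
  define h where "h s = mod_Z (of_int (SOME k. \<exists>\<kappa>\<in>?A. s = \<kappa> \<otimes>\<^bsub>D\<^esub> \<alpha> [^]\<^bsub>D\<^esub> (k::int)) * t)" for s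
  have h: "h (\<kappa> \<otimes>\<^bsub>D\<^esub> \<alpha> [^]\<^bsub>D\<^esub> k) = mod_Z (of_int k * t)" if \<kappa>: "\<kappa> \<in> ?A" for \<kappa> k
  proof -
    let ?s = "\<kappa> \<otimes>\<^bsub>D\<^esub> \<alpha> [^]\<^bsub>D\<^esub> k"
    define l where "l = (SOME k. \<exists>\<kappa>\<in>?A. ?s = \<kappa> \<otimes>\<^bsub>D\<^esub> \<alpha> [^]\<^bsub>D\<^esub> (k::int))"
    have "\<exists>\<mu>\<in>?A. ?s = \<mu> \<otimes>\<^bsub>D\<^esub> \<alpha> [^]\<^bsub>D\<^esub> l"
      unfolding l_def by (rule someI) (use \<kappa> in blast)
    then obtain \<mu> where \<mu>: "\<mu> \<in> ?A" "?s = \<mu> \<otimes>\<^bsub>D\<^esub> \<alpha> [^]\<^bsub>D\<^esub> l" by blast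
    have "\<alpha> [^]\<^bsub>D\<^esub> (l - k) = inv\<^bsub>D\<^esub> \<mu> \<otimes>\<^bsub>D\<^esub> (\<mu> \<otimes>\<^bsub>D\<^esub> \<alpha> [^]\<^bsub>D\<^esub> l) \<otimes>\<^bsub>D\<^esub> inv\<^bsub>D\<^esub> (\<alpha> [^]\<^bsub>D\<^esub> k)"
      using AD[OF \<mu>(1)] \<alpha> by (simp add: D.int_pow_diff D.m_assoc[symmetric])
    also have "\<dots> = inv\<^bsub>D\<^esub> \<mu> \<otimes>\<^bsub>D\<^esub> \<kappa>"
      using AD[OF \<mu>(1)] AD[OF \<kappa>] \<alpha> by (simp add: \<mu>(2)[symmetric] D.m_assoc)
    finally have "l - k \<in> P" using \<kappa> \<mu>(1) by (simp add: P_def)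
    then have "mod_Z (of_int l * t) = mod_Z (of_int k * t)"
      using tP[of "l - k"] by (simp add: mod_Z_eq_iff left_diff_distrib)
    then show ?thesis by (simp only: h_def l_def)
  qed
  have "h \<in> hom (D\<lparr>carrier := S\<rparr>) QZ"
  proof (rule homI)
    fix s s' assume "s \<in> carrier (D\<lparr>carrier := S\<rparr>)" "s' \<in> carrier (D\<lparr>carrier := S\<rparr>)"
    then have "s \<in> S" "s' \<in> S" by simp_all
    then obtain \<kappa> k \<mu> l where s: "\<kappa> \<in> ?A" "s = \<kappa> \<otimes>\<^bsub>D\<^esub> \<alpha> [^]\<^bsub>D\<^esub> (k::int)" "\<mu> \<in> ?A" "s' = \<mu> \<otimes>\<^bsub>D\<^esub> \<alpha> [^]\<^bsub>D\<^esub> (l::int)"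
      unfolding S_def by blast
    have "h (s \<otimes>\<^bsub>D\<^esub> s') = mod_Z (of_int (k + l) * t)"
      unfolding s S_mult[OF s(1,3)] using s by (intro h) simp
    then show "h (s \<otimes>\<^bsub>D\<lparr>carrier := S\<rparr>\<^esub> s') = h s \<otimes>\<^bsub>QZ\<^esub> h s'"
      using h[OF s(1), of k] h[OF s(3), of l] by (simp add: s(2,4) mod_Z_mult distrib_right)
  qed (simp add: h_def)
  then obtain u where u: "u \<in> carrier V" and hu: "\<And>s. s \<in> S \<Longrightarrow> h s = mod_Z (dual_ext M s u)"
    using QZ_hom_is_evaluation[OF S] by blast
  have "u \<in> Msharp"
    unfolding mem_Msharp_iff
  proof (intro conjI u ballI)
    fix x assume x: "x \<in> carrier M"
    have "adj M f x \<in> S" using SI[of "adj M f x" 0] x by simp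
    moreover have "h (adj M f x) = \<one>\<^bsub>QZ\<^esub>" using h[of "adj M f x" 0] x by (simp add: mod_Z_0)
    ultimately show "form_ext M f (\<iota> x) u \<in> \<int>"
      using hu x u by (simp add: form_ext_lattice mod_Z_eq_one_iff)
  qed
  then have "mod_Z (dual_ext M \<alpha> u) = \<one>\<^bsub>QZ\<^esub>" using assms(2) by (simp add: mod_Z_eq_one_iff)
  moreover have "mod_Z (dual_ext M \<alpha> u) = mod_Z t"
    using hu[of \<alpha>] SI[OF A.one_closed, of 1] h[OF A.one_closed, of 1] \<alpha> by simp
  ultimately show False using t by (simp add: mod_Z_eq_one_iff)
qed

text \<open>By the last hypothesis \<open>h u\<close> depends only on the form \<open>f(u, -)\<close>, so \<open>h\<close> is a homomorphism on the
  group of these forms and hence the evaluation at a vector \<open>y\<close>, that is, \<open>h u = f(u, y)\<close> modulo the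
  integers. As \<open>h\<close> kills the lattice, \<open>y\<close> lies in the dual lattice, and \<open>\<alpha> = f(y, -)\<close> has the
  required property.\<close>

lemma dual_lattice_QZ_hom_represented:
  assumes h: "h \<in> hom (V\<lparr>carrier := Msharp\<rparr>) QZ"
    and lat: "\<And>x. x \<in> carrier M \<Longrightarrow> h (\<iota> x) = \<one>\<^bsub>QZ\<^esub>"
    and rad: "\<And>u. u \<in> Msharp \<Longrightarrow> flat u = \<one>\<^bsub>D\<^esub> \<Longrightarrow> h u = \<one>\<^bsub>QZ\<^esub>"
  shows "\<exists>\<alpha>\<in>carrier D. \<forall>u\<in>Msharp. h u = mod_Z (dual_ext M \<alpha> u)"
proof -
  let ?Msharp = "V\<lparr>carrier := Msharp\<rparr>"
  interpret Msharp: group ?Msharp by (rule V.subgroup_imp_group[OF Msharp_subgroup])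
  interpret h: group_hom ?Msharp QZ h
    using h by (simp add: group_hom_def group_hom_axioms_def Msharp.is_group)
  have "flat \<in> hom ?Msharp D" by (rule homI) (simp_all add: flat_closed flat_mult)
  then interpret flat: group_hom ?Msharp D flat
    by (simp add: group_hom_def group_hom_axioms_def Msharp.is_group D.is_group)
  have wd: "h u = h v" if "u \<in> Msharp" "v \<in> Msharp" "flat u = flat v" for u v
  proof -
    let ?w = "u \<otimes>\<^bsub>V\<^esub> inv\<^bsub>?Msharp\<^esub> v"
    have v': "inv\<^bsub>?Msharp\<^esub> v \<in> Msharp" using Msharp.inv_closed[of v] that by simp
    have "flat ?w = \<one>\<^bsub>D\<^esub>"
      using that flat.hom_mult[of u "inv\<^bsub>?Msharp\<^esub> v"] v' flat_closed[OF that(2)] by simp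
    moreover have "?w \<in> Msharp" using Msharp.m_closed[of u "inv\<^bsub>?Msharp\<^esub> v"] that v' by simp
    ultimately have "h ?w = \<one>\<^bsub>QZ\<^esub>" by (intro rad)
    then have "h u \<otimes>\<^bsub>QZ\<^esub> inv\<^bsub>QZ\<^esub> h v = \<one>\<^bsub>QZ\<^esub>"
      using h.hom_mult[of u "inv\<^bsub>?Msharp\<^esub> v"] that v' by simp
    then show ?thesis
      using h.H.inv_equality[of "h u" "inv\<^bsub>QZ\<^esub> h v"] that h.hom_closed[of u] h.hom_closed[of v] by simp
  qed
  obtain g where g: "\<And>u. u \<in> Msharp \<Longrightarrow> g (flat u) = h u"
    using function_factors_left_gen[of "\<lambda>u. u \<in> Msharp" flat h] wd by metis
  have "subgroup (flat ` Msharp) D" using flat.img_is_subgroup by simp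
  moreover have "g \<in> hom (D\<lparr>carrier := flat ` Msharp\<rparr>) QZ"
  proof (rule homI)
    fix s s' assume "s \<in> carrier (D\<lparr>carrier := flat ` Msharp\<rparr>)" "s' \<in> carrier (D\<lparr>carrier := flat ` Msharp\<rparr>)"
    then obtain u v where uv: "u \<in> Msharp" "v \<in> Msharp" "s = flat u" "s' = flat v" by auto
    have "g (flat u \<otimes>\<^bsub>D\<^esub> flat v) = h (u \<otimes>\<^bsub>V\<^esub> v)"
      using uv Msharp.m_closed[of u v] g[of "u \<otimes>\<^bsub>V\<^esub> v"] by (simp add: flat_mult)
    then show "g (s \<otimes>\<^bsub>D\<lparr>carrier := flat ` Msharp\<rparr>\<^esub> s') = g s \<otimes>\<^bsub>QZ\<^esub> g s'"
      using uv h.hom_mult[of u v] by (simp add: g)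
  qed (use g h.hom_closed in auto)
  ultimately obtain y where y: "y \<in> carrier V"
    and gy: "\<And>u. u \<in> Msharp \<Longrightarrow> g (flat u) = mod_Z (dual_ext M (flat u) y)"
    using QZ_hom_is_evaluation[of "flat ` Msharp" g] by (metis imageI)
  have hy: "h u = mod_Z (form_ext M f u y)" if "u \<in> Msharp" for u
    using that y by (simp add: g[symmetric] gy dual_ext_flat)
  have yMS: "y \<in> Msharp"
    unfolding mem_Msharp_iff
  proof (intro conjI y ballI)
    fix x assume x: "x \<in> carrier M"
    then have "\<iota> x \<in> Msharp" using L_Msharp by (auto simp: lattice_image_def)
    then show "form_ext M f (\<iota> x) y \<in> \<int>"
      using hy[of "\<iota> x"] lat[OF x] mod_Z_eq_one_iff by metis
  qed
  show ?thesis
  proof (intro bexI[of _ "flat y"] ballI)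
    show "flat y \<in> carrier D" using yMS by (rule flat_closed)
    show "h u = mod_Z (dual_ext M (flat y) u)" if "u \<in> Msharp" for u
      using that y hy yMS by (simp add: dual_ext_flat Msharp_V form_ext_sym[of u])
  qed
qed

section \<open>The radical\<close>

abbreviation "K \<equiv> ker_adj M f"

lemma carrier_K: "carrier K = {x \<in> carrier M. \<forall>y\<in>carrier M. f x y = 0}"
proof -
  have "adj M f x = \<one>\<^bsub>D\<^esub> \<longleftrightarrow> (\<forall>y\<in>carrier M. f x y = 0)" if "x \<in> carrier M" for x
  proof
    assume "adj M f x = \<one>\<^bsub>D\<^esub>"
    then show "\<forall>y\<in>carrier M. f x y = 0"
      using that by (metis adj_apply dual_simps(1) D.one_closed)
  next
    assume "\<forall>y\<in>carrier M. f x y = 0"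
    then show "adj M f x = \<one>\<^bsub>D\<^esub>"
      using that by (intro dual_eqI) (auto simp: adj_apply dual_simps(1)[OF _ D.one_closed])
  qed
  then show ?thesis by (auto simp: ker_adj_def kernel_def)
qed

lemma K_subgroup: "subgroup (carrier K) M"
  unfolding ker_adj_def using group_hom.subgroup_kernel[OF adj_hom] by simp

lemma K_mult [simp]: "x \<otimes>\<^bsub>K\<^esub> y = x \<otimes> y" "\<one>\<^bsub>K\<^esub> = \<one>"
  by (simp_all add: ker_adj_def)

sublocale K: comm_group K
proof -
  have "comm_group (M\<lparr>carrier := carrier K\<rparr>)"
    by (rule group.group_comm_groupI[OF subgroup_imp_group[OF K_subgroup]])
      (auto simp: carrier_K m_comm)
  then show "comm_group K" by (simp add: ker_adj_def)
qed

lemma K_M: "k \<in> carrier K \<Longrightarrow> k \<in> carrier M"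
  by (simp add: carrier_K)

text \<open>The radical is cut out by the finitely many forms \<open>f(e, -)\<close> with \<open>e\<close> in a basis.\<close>

lemma radical_retraction:
  obtains \<rho> where "\<rho> \<in> hom M M" "\<And>x. x \<in> carrier M \<Longrightarrow> \<rho> x \<in> carrier K" "\<And>x. x \<in> carrier K \<Longrightarrow> \<rho> x = x"
proof -
  obtain n :: nat and e where e: "\<And>i. i < n \<Longrightarrow> e i \<in> carrier M" "carrier M = generate M (e ` {..<n})"
    by (rule basis) blast
  have K_gen: "x \<in> carrier K" if x: "x \<in> carrier M" and 0: "\<forall>i<n. adj M f (e i) x = 0" for x
  proof -
    have "y \<in> carrier M \<and> adj M f x y = 0" if "y \<in> generate M (e ` {..<n})" for y
      using that
    proof induction
      case one
      then show ?case using x dual_apply_simps(1)[of "adj M f x" x] by simp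
    next
      case (incl y)
      then show ?case using e(1) x 0 by (auto simp: adj_apply f_sym[of x])
    next
      case (inv y)
      then show ?case using e(1) x 0 by (auto simp: dual_apply_simps) (auto simp: adj_apply f_sym[of x])
    next
      case (eng y z)
      then show ?case using x by (simp add: dual_apply_simps)
    qed
    then show ?thesis using x e(2) by (auto simp: carrier_K adj_apply)
  qed
  have "adj M f (e i) \<in> hom M integer_group" if "i < n" for i
    using adj_closed[OF e(1)[OF that]] by (simp add: dual_def carrier_hom_group)
  from int_homs_retraction[of n "\<lambda>i. adj M f (e i)", OF this] obtain \<rho> where \<rho>: "\<rho> \<in> hom M M"
    "\<And>x. x \<in> carrier M \<Longrightarrow> \<forall>i<n. adj M f (e i) (\<rho> x) = 0"
    "\<And>x. x \<in> carrier M \<Longrightarrow> \<forall>i<n. adj M f (e i) x = 0 \<Longrightarrow> \<rho> x = x" by auto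
  show thesis
  proof
    show "\<rho> \<in> hom M M" by fact
    show "\<rho> x \<in> carrier K" if "x \<in> carrier M" for x
      using that \<rho>(2) hom_in_carrier[OF \<rho>(1)] by (intro K_gen) auto
    show "\<rho> x = x" if "x \<in> carrier K" for x
      using that e(1) by (intro \<rho>(3)) (auto simp: carrier_K adj_apply f_sym)
  qed
qed

section \<open>The discriminant group\<close>

abbreviation "G \<equiv> discr_group M f"
abbreviation "cl \<equiv> discr_class M"
abbreviation "Vsharp \<equiv> V\<lparr>carrier := Msharp\<rparr>"

sublocale Vsharp: comm_group Vsharp
  by (rule group.group_comm_groupI[OF V.subgroup_imp_group[OF Msharp_subgroup]])
    (auto simp: Msharp_V V.m_comm)

lemma L_Vsharp: "subgroup L Vsharp"
  by (rule V.subgroup_incl[OF L_subgroup Msharp_subgroup L_Msharp])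

lemma cl_Vsharp: "cl u = L #>\<^bsub>Vsharp\<^esub> u"
  by (simp add: discr_class_def r_coset_def)

lemma G_eq: "G = Vsharp Mod L"
  by (simp add: discr_group_def)

sublocale G: comm_group G
  unfolding G_eq by (rule Vsharp.abelian_FactGroup[OF L_Vsharp])

lemma carrier_G: "carrier G = cl ` Msharp"
  by (simp add: G_eq carrier_FactGroup cl_Vsharp)

lemma G_cases:
  assumes "X \<in> carrier G" obtains u where "u \<in> Msharp" "X = cl u"
  using assms by (auto simp: carrier_G)

lemma cl_closed [simp]: "u \<in> Msharp \<Longrightarrow> cl u \<in> carrier G"
  by (simp add: carrier_G)

lemma cl_hom: "group_hom Vsharp G cl"
proof -
  have "L \<lhd> Vsharp" by (rule Vsharp.subgroup_imp_normal[OF L_Vsharp])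
  then have "cl \<in> hom Vsharp G"
    unfolding cl_Vsharp[abs_def] G_eq by (rule normal.r_coset_hom_Mod)
  then show ?thesis by (simp add: group_hom_def group_hom_axioms_def Vsharp.is_group G.is_group)
qed

lemma cl_mult: "u \<in> Msharp \<Longrightarrow> v \<in> Msharp \<Longrightarrow> cl (u \<otimes>\<^bsub>V\<^esub> v) = cl u \<otimes>\<^bsub>G\<^esub> cl v"
  using group_hom.hom_mult[OF cl_hom] by simp

lemma cl_eq_iff: "u \<in> carrier V \<Longrightarrow> v \<in> carrier V \<Longrightarrow> cl u = cl v \<longleftrightarrow> u \<otimes>\<^bsub>V\<^esub> inv\<^bsub>V\<^esub> v \<in> L"
  unfolding discr_class_def by (rule V.coset_eq_iff[OF L_subgroup])

lemma cl_eq_one_iff: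
  assumes "u \<in> carrier V" shows "cl u = \<one>\<^bsub>G\<^esub> \<longleftrightarrow> u \<in> L"
proof -
  have "cl \<one>\<^bsub>V\<^esub> = \<one>\<^bsub>G\<^esub>" using group_hom.hom_one[OF cl_hom] by simp
  then show ?thesis using cl_eq_iff[OF assms V.one_closed] assms by simp
qed

lemma mem_cl_iff: "w \<in> cl u \<longleftrightarrow> (\<exists>x\<in>carrier M. w = \<iota> x \<otimes>\<^bsub>V\<^esub> u)"
  by (auto simp: discr_class_def r_coset_def lattice_image_def)

lemma mem_cl_self: "u \<in> carrier V \<Longrightarrow> u \<in> cl u"
  unfolding discr_class_def by (rule V.rcos_self[OF _ L_subgroup])

lemma iota_Msharp: "x \<in> carrier M \<Longrightarrow> \<iota> x \<in> Msharp"
  using L_Msharp by (auto simp: lattice_image_def)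

lemma form_ext_iota_Ints:
  "x \<in> carrier M \<Longrightarrow> u \<in> Msharp \<Longrightarrow> form_ext M f (\<iota> x) u \<in> \<int>"
  "x \<in> carrier M \<Longrightarrow> u \<in> Msharp \<Longrightarrow> form_ext M f u (\<iota> x) \<in> \<int>"
  by (auto simp: mem_Msharp_iff form_ext_sym[of u])

text \<open>Moving \<open>u\<close> and \<open>v\<close> by lattice vectors changes the form by integers, since both lie in the dual
  lattice.\<close>

lemma discr_form_cl:
  assumes "u \<in> Msharp" "v \<in> Msharp"
  shows "discr_form M f (cl u) (cl v) = mod_Z (form_ext M f u v)"
proof -
  have "the_elem ((\<lambda>(x, y). mod_Z (form_ext M f x y)) ` (cl u \<times> cl v)) =
      (\<lambda>(x, y). mod_Z (form_ext M f x y)) (u, v)"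
  proof (rule the_elem_image_const)
    show "(u, v) \<in> cl u \<times> cl v" using assms Msharp_V mem_cl_self by simp
    fix p assume "p \<in> cl u \<times> cl v"
    then obtain x y where xy: "x \<in> carrier M" "y \<in> carrier M" "p = (\<iota> x \<otimes>\<^bsub>V\<^esub> u, \<iota> y \<otimes>\<^bsub>V\<^esub> v)"
      by (auto simp: mem_cl_iff)
    have "form_ext M f (\<iota> x) (\<iota> y) + form_ext M f (\<iota> x) v + form_ext M f u (\<iota> y) \<in> \<int>"
      using xy assms by (intro Ints_add form_ext_iota_Ints iota_Msharp)
    then show "(\<lambda>(x, y). mod_Z (form_ext M f x y)) p = (\<lambda>(x, y). mod_Z (form_ext M f x y)) (u, v)"
      using xy assms Msharp_V
      by (simp add: mod_Z_eq_iff form_ext_mult_left form_ext_mult_right algebra_simps)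
  qed
  then show ?thesis by (simp add: discr_form_def)
qed

lemma discr_form_bilinear: "bilinear_QZ G (discr_form M f)"
  unfolding bilinear_QZ_def
proof (intro conjI ballI)
  fix X Y assume "X \<in> carrier G" "Y \<in> carrier G"
  then obtain u v where uv: "u \<in> Msharp" "v \<in> Msharp" "X = cl u" "Y = cl v" by (metis G_cases)
  then show "discr_form M f X Y \<in> carrier QZ" by (simp add: discr_form_cl)
  fix Z assume "Z \<in> carrier G"
  then obtain w where w: "w \<in> Msharp" "Z = cl w" by (metis G_cases)
  note closed = subgroup.m_closed[OF Msharp_subgroup]
  show "discr_form M f (X \<otimes>\<^bsub>G\<^esub> Y) Z = discr_form M f X Z \<otimes>\<^bsub>QZ\<^esub> discr_form M f Y Z"
    using uv w closed[of u v] by (simp add: cl_mult[symmetric] discr_form_cl mod_Z_mult form_ext_mult_left Msharp_V)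
  show "discr_form M f X (Y \<otimes>\<^bsub>G\<^esub> Z) = discr_form M f X Y \<otimes>\<^bsub>QZ\<^esub> discr_form M f X Z"
    using uv w closed[of v w] by (simp add: cl_mult[symmetric] discr_form_cl mod_Z_mult form_ext_mult_right Msharp_V)
qed

abbreviation "HG \<equiv> hom_group G QZ"

sublocale HG: comm_group HG by (rule comm_group_hom_group) simp_all

lemma discr_adj_hom: "group_hom G (hom_group G QZ) (discr_adj M f)"
proof -
  have "discr_adj M f \<in> hom G (hom_group G QZ)"
  proof (rule homI)
    show closed: "discr_adj M f X \<in> carrier (hom_group G QZ)" if "X \<in> carrier G" for X
      unfolding discr_adj_def
      by (rule hom_group_restrictI)
        (use that discr_form_bilinear in \<open>auto simp: bilinear_QZ_def intro!: homI\<close>)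
    fix X Y assume XY: "X \<in> carrier G" "Y \<in> carrier G"
    show "discr_adj M f (X \<otimes>\<^bsub>G\<^esub> Y) = discr_adj M f X \<otimes>\<^bsub>hom_group G QZ\<^esub> discr_adj M f Y"
    proof (rule hom_group_eqI)
      show "discr_adj M f X \<otimes>\<^bsub>hom_group G QZ\<^esub> discr_adj M f Y \<in> carrier (hom_group G QZ)"
        using XY closed by (intro HG.m_closed)
    qed (use XY closed discr_form_bilinear in \<open>auto simp: mult_hom_group discr_adj_def bilinear_QZ_def\<close>)
  qed
  then show ?thesis
    by (simp add: group_hom_def group_hom_axioms_def HG.is_group)
qed

section \<open>The kernel of the discriminant form\<close>

abbreviation "KD \<equiv> ker_discr_adj M f"

lemma KD_subgroup: "subgroup (carrier KD) G"
  unfolding ker_discr_adj_def using group_hom.subgroup_kernel[OF discr_adj_hom] by simp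

lemma KD_simps [simp]: "X \<otimes>\<^bsub>KD\<^esub> Y = X \<otimes>\<^bsub>G\<^esub> Y" "\<one>\<^bsub>KD\<^esub> = \<one>\<^bsub>G\<^esub>"
  by (simp_all add: ker_discr_adj_def)

lemma KD_eq: "KD = G\<lparr>carrier := carrier KD\<rparr>"
  by (simp add: ker_discr_adj_def)

lemma KD_G: "X \<in> carrier KD \<Longrightarrow> X \<in> carrier G"
  using KD_subgroup by (rule subgroup.mem_carrier)

sublocale KD: comm_group KD
proof -
  have "comm_group (G\<lparr>carrier := carrier KD\<rparr>)"
    by (rule group.group_comm_groupI[OF G.subgroup_imp_group[OF KD_subgroup]])
      (auto simp: KD_G G.m_comm)
  then show "comm_group KD" by (simp add: KD_eq[symmetric])
qed

lemma cl_KD_iff: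
  assumes "u \<in> Msharp"
  shows "cl u \<in> carrier KD \<longleftrightarrow> (\<forall>v\<in>Msharp. form_ext M f u v \<in> \<int>)"
proof -
  have "cl u \<in> carrier KD \<longleftrightarrow> discr_adj M f (cl u) = \<one>\<^bsub>hom_group G QZ\<^esub>"
    using assms by (simp add: ker_discr_adj_def kernel_def)
  also have "\<dots> \<longleftrightarrow> (\<forall>X\<in>carrier G. discr_form M f (cl u) X = \<one>\<^bsub>QZ\<^esub>)"
    by (auto simp: discr_adj_def hom_group_def fun_eq_iff restrict_def)
  also have "\<dots> \<longleftrightarrow> (\<forall>v\<in>Msharp. form_ext M f u v \<in> \<int>)"
    using assms by (simp add: carrier_G discr_form_cl mod_Z_eq_one_iff)
  finally show ?thesis .
qed

lemma form_ext_K: "k \<in> carrier K \<Longrightarrow> v \<in> carrier V \<Longrightarrow> form_ext M f (tens k r) v = 0"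
  using V_pure[of v] by (auto simp: form_ext_tens carrier_K)

lemma tens_K_Msharp: "k \<in> carrier K \<Longrightarrow> tens k r \<in> Msharp"
  by (auto simp: mem_Msharp_iff K_M form_ext_sym[of _ "tens k r"] form_ext_K)

lemma cl_tens_K: "k \<in> carrier K \<Longrightarrow> cl (tens k r) \<in> carrier KD"
  by (simp add: cl_KD_iff tens_K_Msharp form_ext_K Msharp_V)

text \<open>If \<open>f(u, -)\<close> is integral on the dual lattice, it equals \<open>f(m, -)\<close> for a lattice vector \<open>m\<close>, by
  duality. So \<open>u - m\<close> has the class of \<open>u\<close> and lies in the rational radical.\<close>

lemma KD_cases:
  assumes "X \<in> carrier KD"
  obtains k r where "k \<in> carrier K" "X = cl (tens k r)"
proof -
  obtain u where u: "u \<in> Msharp" "X = cl u" using assms KD_G G_cases by metis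
  then have int: "form_ext M f u v \<in> \<int>" if "v \<in> Msharp" for v using assms cl_KD_iff that by simp
  have "flat u \<in> adj M f ` carrier M"
    using u int by (intro integral_on_dual_lattice_imp_adj flat_closed) (simp_all add: dual_ext_flat Msharp_V)
  then obtain m where m: "m \<in> carrier M" "flat u = adj M f m" by auto
  define w where "w = u \<otimes>\<^bsub>V\<^esub> inv\<^bsub>V\<^esub> \<iota> m"
  have wV: "w \<in> carrier V" using u m by (simp add: w_def Msharp_V)
  have cl: "cl w = cl u"
  proof (rule cl_eq_iff[THEN iffD2])
    have "w \<otimes>\<^bsub>V\<^esub> inv\<^bsub>V\<^esub> u = inv\<^bsub>V\<^esub> \<iota> m"
      using u m Msharp_V[of u] by (simp add: w_def V.m_comm[of u] V.m_assoc)
    moreover have "\<iota> m \<in> L" using m by (simp add: lattice_image_def)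
    ultimately show "w \<otimes>\<^bsub>V\<^esub> inv\<^bsub>V\<^esub> u \<in> L" using L_subgroup subgroup.m_inv_closed by metis
  qed (use u wV Msharp_V in auto)
  have w0: "form_ext M f w (\<iota> y) = 0" if "y \<in> carrier M" for y
    using u m that Msharp_V[of u]
    by (simp add: w_def form_ext_mult_left form_ext_inv_left form_ext_lattice dual_ext_flat[symmetric])
  obtain x r where x: "x \<in> carrier M" "w = tens x r" using V_pure[OF wV] by blast
  show thesis
  proof (cases "r = 0")
    case True
    then have "w = tens \<one> 0"
      using x group_hom.hom_one[OF tens_hom_rat, of x] group_hom.hom_one[OF tens_hom_rat, of \<one>] by simp
    then show ?thesis using that[of \<one> 0] u cl K.one_closed by simp
  next
    case False
    have "x \<in> carrier K"
      using x w0 False by (auto simp: carrier_K form_ext_tens)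
    then show ?thesis using that[of x r] u(2) cl x(2) by simp
  qed
qed

text \<open>The counterpart for the quotient: if \<open>f(u, -) = 0\<close>, the class of \<open>u\<close> is in the kernel of the
  adjoint of the discriminant form.\<close>

lemma hom_vanishing_on_kernel_is_pairing:
  assumes h: "h \<in> carrier (hom_group G QZ)" and ker: "\<And>X. X \<in> carrier KD \<Longrightarrow> h X = \<one>\<^bsub>QZ\<^esub>"
  shows "\<exists>\<alpha>\<in>carrier D. \<forall>u\<in>Msharp. h (cl u) = mod_Z (dual_ext M \<alpha> u)"
proof -
  interpret h: group_hom G QZ h using h by (rule hom_group_group_hom) simp_all
  have "(\<lambda>u. h (cl u)) \<in> hom Vsharp QZ"
    by (rule homI) (simp_all add: cl_mult)
  then show ?thesis
  proof (rule dual_lattice_QZ_hom_represented)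
    show "h (cl (\<iota> x)) = \<one>\<^bsub>QZ\<^esub>" if "x \<in> carrier M" for x
    proof -
      have "cl (\<iota> x) = \<one>\<^bsub>G\<^esub>" using that by (simp add: cl_eq_one_iff lattice_image_def)
      then show ?thesis by simp
    qed
    show "h (cl u) = \<one>\<^bsub>QZ\<^esub>" if "u \<in> Msharp" "flat u = \<one>\<^bsub>D\<^esub>" for u
    proof (rule ker)
      have "form_ext M f u v = 0" if "v \<in> Msharp" for v
        using \<open>flat u = \<one>\<^bsub>D\<^esub>\<close> that dual_ext_flat[OF \<open>u \<in> Msharp\<close>, of v]
          group_hom.hom_one[OF dual_ext_hom_dual[of v]] by (simp add: Msharp_V)
      then show "cl u \<in> carrier KD" using that by (simp add: cl_KD_iff)
    qed
  qed
qed

section \<open>The identification of the kernel and the map j\<close>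

sublocale KQ: comm_group_pair K QZ
  by (simp add: comm_group_pair_def K.comm_group_axioms)

abbreviation "TK \<equiv> tensor_group K QZ"
abbreviation "tensK \<equiv> pure_tensor K QZ"

lemma K_int_pow:
  assumes "k \<in> carrier K" shows "k [^]\<^bsub>K\<^esub> (n::int) = k [^] n"
proof -
  have "K = M\<lparr>carrier := carrier K\<rparr>" by (simp add: ker_adj_def)
  then show ?thesis using int_pow_consistent[OF K_subgroup assms, of n] by simp
qed

lemma cl_tens_cong:
  assumes "k \<in> carrier M" "r - s \<in> \<int>"
  shows "cl (tens k r) = cl (tens k s)"
proof -
  obtain z where z: "r - s = of_int z" using assms(2) by (rule Ints_cases)
  interpret t: group_hom rat_group V "tens k" using assms(1) by (rule tens_hom_rat)
  have "tens k r \<otimes>\<^bsub>V\<^esub> inv\<^bsub>V\<^esub> tens k s = tens k (r - s)"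
    using t.hom_mult[of r "- s"] t.hom_inv[of s] by simp
  also have "\<dots> = \<iota> (k [^] z)" using assms(1) by (simp add: z tens_int_pow)
  finally show ?thesis using assms(1) by (simp add: cl_eq_iff lattice_image_def)
qed

lemma cl_tens_K_mult:
  "k \<in> carrier K \<Longrightarrow> l \<in> carrier K \<Longrightarrow> cl (tens (k \<otimes> l) r) = cl (tens k r) \<otimes>\<^bsub>G\<^esub> cl (tens l r)"
  "k \<in> carrier K \<Longrightarrow> cl (tens k (r + s)) = cl (tens k r) \<otimes>\<^bsub>G\<^esub> cl (tens k s)"
  by (simp_all add: tens_mult tens_add K_M cl_mult tens_K_Msharp)

lemma QZ_cases: "R \<in> carrier QZ \<Longrightarrow> \<exists>r. R = mod_Z r"
  by (auto simp: carrier_QZ)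

lemma
  shows ker_ident_hom: "group_hom TK KD (ker_ident M f)"
    and ker_ident_tens: "\<And>k r. k \<in> carrier K \<Longrightarrow> ker_ident M f (tensK k (mod_Z r)) = cl (tens k r)"
proof -
  \<comment> \<open>the value does not depend on the representative, as \<open>k \<otimes> z\<close> is a lattice vector for an integer \<open>z\<close>\<close>
  define \<beta> where "\<beta> k R = the_elem ((\<lambda>r. cl (tens k r)) ` R)" for k R
  have \<beta>: "\<beta> k (mod_Z r) = cl (tens k r)" if "k \<in> carrier K" for k r
    unfolding \<beta>_def
  proof (rule the_elem_image_const)
    show "cl (tens k s) = cl (tens k r)" if "s \<in> mod_Z r" for s
      using that K_M[OF \<open>k \<in> carrier K\<close>] by (intro cl_tens_cong) (simp_all add: mem_mod_Z_iff)
  qed (simp add: mem_mod_Z_iff)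
  have eq: "ker_ident M f = tensor_lift K QZ KD \<beta>"
    by (simp add: ker_ident_def \<beta>_def[abs_def])
  note lift = KQ.tensor_lift[where C = KD and \<beta> = \<beta>, OF KD.comm_group_axioms]
  have "tensor_lift K QZ KD \<beta> \<in> hom TK KD"
    by (rule lift) (auto dest!: QZ_cases simp: \<beta> cl_tens_K cl_tens_K_mult mod_Z_mult subgroup.m_closed[OF K_subgroup])
  then show "group_hom TK KD (ker_ident M f)"
    by (simp add: eq group_hom_def group_hom_axioms_def)
  show "ker_ident M f (tensK k (mod_Z r)) = cl (tens k r)" if "k \<in> carrier K" for k r
  proof -
    have "tensor_lift K QZ KD \<beta> (tensK k (mod_Z r)) = \<beta> k (mod_Z r)"
      by (rule lift) (use that in \<open>auto dest!: QZ_cases simp: \<beta> cl_tens_K cl_tens_K_mult mod_Z_mult subgroup.m_closed[OF K_subgroup]\<close>)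
    then show ?thesis using \<beta>[OF that] by (simp add: eq)
  qed
qed

lemma TK_pure: "t \<in> carrier TK \<Longrightarrow> \<exists>k\<in>carrier K. \<exists>r. t = tensK k (mod_Z r)"
  using KQ.tensor_pure[OF QZ_locally_cyclic, of t] QZ_cases by metis

text \<open>For injectivity, let the class of \<open>k \<otimes> p/q\<close> vanish. Then \<open>k \<otimes> p/q = m \<otimes> 1\<close> for a lattice vector
  \<open>m\<close>, hence \<open>p k = q m\<close> because the lattice is torsion-free. So \<open>m\<close> is in the radical too, and
  \<open>k \<otimes> [p/q] = p k \<otimes> [1/q] = q m \<otimes> [1/q] = m \<otimes> [1] = 0\<close>.\<close>

lemma ker_ident_iso: "ker_ident M f \<in> iso TK KD"
proof -
  interpret i: group_hom TK KD "ker_ident M f" by (rule ker_ident_hom)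
  have "t = \<one>\<^bsub>TK\<^esub>" if t: "t \<in> carrier TK" and one: "ker_ident M f t = \<one>\<^bsub>KD\<^esub>" for t
  proof -
    obtain k r where k: "k \<in> carrier K" and tk: "t = tensK k (mod_Z r)" using TK_pure[OF t] by blast
    obtain p q :: int where r: "r = of_int p / of_int q" "q > 0"
      by (metis Fract_of_int_quotient Rat_cases)
    define s where "s = (1 :: rat) / of_int q"
    have rs: "r = of_int p * s" "of_int q * s = 1" "s \<noteq> 0" using r by (simp_all add: s_def)
    have kM: "k \<in> carrier M" using k by (rule K_M)
    have "tens k r \<in> L"
      using one k by (simp add: tk ker_ident_tens cl_eq_one_iff K_M)
    then obtain m where m: "m \<in> carrier M" "tens k r = \<iota> m" by (auto simp: lattice_image_def)
    have "tens (k [^] p) s = tens (m [^] q) s"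
      using m kM by (simp add: tens_int_pow rs)
    moreover interpret ts: group_hom M V "\<lambda>x. tens x s" by (rule tens_hom)
    have "tens (k [^] p \<otimes> inv (m [^] q)) s = tens (k [^] p) s \<otimes>\<^bsub>V\<^esub> inv\<^bsub>V\<^esub> tens (m [^] q) s"
      using m kM ts.hom_mult[of "k [^] p" "inv (m [^] q)"] ts.hom_inv[of "m [^] q"] by simp
    ultimately have "tens (k [^] p \<otimes> inv (m [^] q)) s = \<one>\<^bsub>V\<^esub>"
      using m(1) by simp
    then have "k [^] p \<otimes> inv (m [^] q) = \<one>"
      using m(1) kM rs(3) by (intro tens_eq_one[of _ s]) simp_all
    then have kp: "k [^] p = m [^] q"
      using m(1) kM inv_equality[of "k [^] p" "inv (m [^] q)"] by simp
    have mK: "m \<in> carrier K"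
      unfolding carrier_K
    proof (intro CollectI conjI ballI m(1))
      fix y assume y: "y \<in> carrier M"
      have "q * adj M f y m = adj M f y (k [^] p)"
        using y m(1) by (simp add: kp dual_apply_simps)
      also have "\<dots> = p * f k y" using y kM by (simp add: dual_apply_simps) (simp add: adj_apply f_sym)
      also have "\<dots> = 0" using k y by (simp add: carrier_K)
      finally show "f m y = 0" using y m(1) r(2) by (simp add: adj_apply f_sym)
    qed
    have "t = tensK (k [^]\<^bsub>K\<^esub> p) (mod_Z s)"
      using k by (simp add: tk rs(1) KQ.tens_balanced mod_Z_int_pow)
    also have "\<dots> = tensK (m [^]\<^bsub>K\<^esub> q) (mod_Z s)"
      using k mK kp by (simp add: K_int_pow)
    also have "\<dots> = tensK m (mod_Z (of_int q * s))"
      using mK by (simp add: KQ.tens_balanced mod_Z_int_pow)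
    also have "mod_Z (of_int q * s) = \<one>\<^bsub>QZ\<^esub>"
      using rs(2) by (simp add: mod_Z_eq_one_iff)
    finally show ?thesis using group_hom.hom_one[OF KQ.tens_hom_right[OF mK]] by simp
  qed
  then have "kernel TK KD (ker_ident M f) = {\<one>\<^bsub>TK\<^esub>}"
    using i.hom_one by (auto simp: kernel_def)
  moreover have "ker_ident M f ` carrier TK = carrier KD"
  proof
    show "carrier KD \<subseteq> ker_ident M f ` carrier TK"
    proof
      fix X assume "X \<in> carrier KD"
      then obtain k r where "k \<in> carrier K" "X = cl (tens k r)" by (rule KD_cases)
      then show "X \<in> ker_ident M f ` carrier TK"
        by (intro image_eqI[of _ _ "tensK k (mod_Z r)"]) (simp_all add: ker_ident_tens)
    qed
  qed auto
  ultimately show ?thesis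
    using iso_kernel_image[of TK KD] i.homh by simp
qed

lemma carrier_dual_K: "g \<in> carrier (dual K) \<longleftrightarrow> g \<in> hom K integer_group \<and> g \<in> extensional (carrier K)"
  by (simp add: dual_def carrier_hom_group)

lemma
  assumes "g \<in> carrier (dual K)"
  shows tensor_QZ_hom: "tensor_QZ K g \<in> hom TK QZ"
    and tensor_QZ_tens: "k \<in> carrier K \<Longrightarrow> tensor_QZ K g (tensK k (mod_Z r)) = mod_Z (r * of_int (g k))"
proof -
  have g: "g \<in> hom K integer_group" using assms by (simp add: carrier_dual_K)
  have add: "g (k \<otimes> l) = g k + g l" if "k \<in> carrier K" "l \<in> carrier K" for k l
    using hom_mult[OF g that] by simp
  note lift = KQ.tensor_lift[where C = QZ and \<beta> = "\<lambda>k R. R [^]\<^bsub>QZ\<^esub> g k", OF comm_group_QZ]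
  show "tensor_QZ K g \<in> hom TK QZ"
    unfolding tensor_QZ_def
    by (rule lift) (auto dest!: QZ_cases simp: add mod_Z_simps algebra_simps)
  show "tensor_QZ K g (tensK k (mod_Z r)) = mod_Z (r * of_int (g k))" if "k \<in> carrier K"
  proof -
    have "tensor_QZ K g (tensK k (mod_Z r)) = mod_Z r [^]\<^bsub>QZ\<^esub> g k"
      unfolding tensor_QZ_def
      by (rule lift) (use that in \<open>auto dest!: QZ_cases simp: add mod_Z_simps algebra_simps\<close>)
    then show ?thesis by (simp add: mod_Z_int_pow mult.commute)
  qed
qed

lemma j_map_cl:
  assumes "g \<in> carrier (dual K)" "k \<in> carrier K"
  shows "j_map M f g (cl (tens k r)) = mod_Z (r * of_int (g k))"
proof -
  have inj: "inj_on (ker_ident M f) (carrier TK)"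
    using ker_ident_iso by (simp add: iso_def bij_betw_def)
  have "inv_into (carrier TK) (ker_ident M f) (ker_ident M f (tensK k (mod_Z r))) = tensK k (mod_Z r)"
    using assms(2) by (intro inv_into_f_f[OF inj]) simp
  then show ?thesis
    using assms by (simp add: j_map_def cl_tens_K ker_ident_tens tensor_QZ_tens)
qed

abbreviation "HK \<equiv> hom_group KD QZ"

sublocale HK: comm_group HK by (rule comm_group_hom_group) simp_all

lemma dual_K_comm_group: "comm_group (dual K)"
  unfolding dual_def by (intro comm_group_hom_group K.is_group abelian_integer_group)

lemma j_map_hom: "group_hom (dual K) HK (j_map M f)"
proof -
  have "j_map M f \<in> hom (dual K) HK"
  proof (rule homI)
    show closed: "j_map M f g \<in> carrier HK" if "g \<in> carrier (dual K)" for g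
      unfolding j_map_def
    proof (rule hom_group_restrictI[OF KD.is_group])
      have "inv_into (carrier TK) (ker_ident M f) \<in> hom KD TK"
        using KQ.T.iso_set_sym[OF ker_ident_iso] by (simp add: iso_def)
      from Group.hom_compose[OF this tensor_QZ_hom[OF that]]
      show "(\<lambda>X. tensor_QZ K g (inv_into (carrier TK) (ker_ident M f) X)) \<in> hom KD QZ"
        by (simp add: comp_def)
    qed
    fix g h assume gh: "g \<in> carrier (dual K)" "h \<in> carrier (dual K)"
    have gh': "g \<otimes>\<^bsub>dual K\<^esub> h \<in> carrier (dual K)"
      using gh dual_K_comm_group by (simp add: comm_group_def group.is_monoid monoid.m_closed)
    show "j_map M f (g \<otimes>\<^bsub>dual K\<^esub> h) = j_map M f g \<otimes>\<^bsub>HK\<^esub> j_map M f h"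
    proof (rule hom_group_eqI)
      fix X assume "X \<in> carrier KD"
      then obtain k r where k: "k \<in> carrier K" and X: "X = cl (tens k r)" by (rule KD_cases)
      have "(g \<otimes>\<^bsub>dual K\<^esub> h) k = g k + h k" using k by (simp add: dual_def mult_hom_group)
      then show "j_map M f (g \<otimes>\<^bsub>dual K\<^esub> h) X = (j_map M f g \<otimes>\<^bsub>HK\<^esub> j_map M f h) X"
        using k gh gh' by (simp add: X mult_hom_group cl_tens_K j_map_cl mod_Z_mult distrib_left)
    qed (use gh gh' closed in auto)
  qed
  then show ?thesis
    by (simp add: group_hom_def group_hom_axioms_def HK.is_group comm_group.axioms(2)[OF dual_K_comm_group])
qed

abbreviation "J \<equiv> j_map M f ` carrier (dual K)"

lemma J_subgroup: "subgroup J HK"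
  by (rule group_hom.img_is_subgroup[OF j_map_hom])

section \<open>Extension from the radical\<close>

lemma dual_K_extends:
  assumes "g \<in> carrier (dual K)"
  shows "\<exists>\<alpha>\<in>carrier D. \<forall>k\<in>carrier K. \<alpha> k = g k"
proof -
  obtain \<rho> where \<rho>: "\<rho> \<in> hom M M" "\<And>x. x \<in> carrier M \<Longrightarrow> \<rho> x \<in> carrier K" "\<And>x. x \<in> carrier K \<Longrightarrow> \<rho> x = x"
    by (rule radical_retraction) blast
  have g: "g (x \<otimes> y) = g x + g y" if "x \<in> carrier K" "y \<in> carrier K" for x y
    using assms hom_mult[of g K integer_group x y] that by (simp add: carrier_dual_K)
  have "restrict (\<lambda>x. g (\<rho> x)) (carrier M) \<in> carrier D"
    by (rule dual_restrictI) (simp add: hom_mult[OF \<rho>(1)] g \<rho>(2))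
  then show ?thesis
    by (rule bexI[rotated]) (simp add: K_M \<rho>(3))
qed

lemma dual_K_restrict:
  assumes "\<alpha> \<in> carrier D"
  shows "restrict \<alpha> (carrier K) \<in> carrier (dual K)"
  unfolding dual_def
  by (rule hom_group_restrictI[OF K.is_group]) (use assms in \<open>auto intro!: homI simp: dual_apply_simps K_M\<close>)

text \<open>The retraction \<open>\<rho>\<close> of the lattice onto the radical, tensored with the rationals, maps the lattice to
  itself and takes values in the rational radical; so it induces a retraction of the discriminant
  group onto the kernel of its form, and \<open>h\<close> is composed with it.\<close>

lemma HK_extends:
  assumes "h \<in> carrier HK"
  shows "\<exists>h'\<in>carrier HG. restrict h' (carrier KD) = h"
proof -
  obtain \<rho> where \<rho>: "\<rho> \<in> hom M M" "\<And>x. x \<in> carrier M \<Longrightarrow> \<rho> x \<in> carrier K" "\<And>x. x \<in> carrier K \<Longrightarrow> \<rho> x = x"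
    by (rule radical_retraction) blast
  interpret h: group_hom KD QZ h using assms by (rule hom_group_group_hom) simp_all
  define \<rho>V where "\<rho>V = tensor_lift M rat_group V (\<lambda>x r. tens (\<rho> x) r)"
  note lift = R.tensor_lift[where C = V and \<beta> = "\<lambda>x r. tens (\<rho> x) r", OF V.comm_group_axioms]
  have closed: "\<rho> x \<in> carrier M" if "x \<in> carrier M" for x using \<rho>(2)[OF that] by (rule K_M)
  have \<rho>V_hom: "\<rho>V \<in> hom V V"
    unfolding \<rho>V_def by (subst (2) V_eq) (rule lift; simp add: closed tens_mult tens_add hom_mult[OF \<rho>(1)])
  have \<rho>V_tens: "\<rho>V (tens x r) = tens (\<rho> x) r" if "x \<in> carrier M" for x r
    unfolding \<rho>V_def by (rule lift) (simp_all add: that closed tens_mult tens_add hom_mult[OF \<rho>(1)])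
  have \<rho>V_K: "\<exists>k\<in>carrier K. \<exists>r. \<rho>V u = tens k r" if "u \<in> carrier V" for u
    using V_pure[OF that] \<rho>V_tens \<rho>(2) by metis
  have \<rho>V_Msharp: "\<rho>V u \<in> Msharp" "cl (\<rho>V u) \<in> carrier KD" if "u \<in> carrier V" for u
    using \<rho>V_K[OF that] by (auto simp: tens_K_Msharp cl_tens_K)
  have "(\<lambda>u. h (cl (\<rho>V u))) \<in> hom Vsharp QZ"
  proof (rule homI)
    show "h (cl (\<rho>V u)) \<in> carrier QZ" if "u \<in> carrier Vsharp" for u
      using that \<rho>V_Msharp(2)[of u] Msharp_V by simp
    show "h (cl (\<rho>V (u \<otimes>\<^bsub>Vsharp\<^esub> v))) = h (cl (\<rho>V u)) \<otimes>\<^bsub>QZ\<^esub> h (cl (\<rho>V v))"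
      if "u \<in> carrier Vsharp" "v \<in> carrier Vsharp" for u v
    proof -
      have uv: "u \<in> carrier V" "v \<in> carrier V" using that Msharp_V by auto
      have "cl (\<rho>V (u \<otimes>\<^bsub>V\<^esub> v)) = cl (\<rho>V u) \<otimes>\<^bsub>KD\<^esub> cl (\<rho>V v)"
        using uv \<rho>V_Msharp by (simp add: hom_mult[OF \<rho>V_hom] cl_mult)
      then show ?thesis using uv \<rho>V_Msharp h.hom_mult by simp
    qed
  qed
  then interpret k: group_hom Vsharp QZ "\<lambda>u. h (cl (\<rho>V u))"
    by (simp add: group_hom_def group_hom_axioms_def Vsharp.is_group)
  have "L \<subseteq> kernel Vsharp QZ (\<lambda>u. h (cl (\<rho>V u)))"
  proof
    fix u assume "u \<in> L"
    then obtain x where x: "x \<in> carrier M" "u = \<iota> x" by (auto simp: lattice_image_def)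
    then have "cl (\<rho>V u) = \<one>\<^bsub>KD\<^esub>"
      using closed by (simp add: \<rho>V_tens cl_eq_one_iff lattice_image_def)
    then show "u \<in> kernel Vsharp QZ (\<lambda>u. h (cl (\<rho>V u)))"
      using x h.hom_one by (simp add: kernel_def iota_Msharp)
  qed
  then obtain h' where h': "h' \<in> hom (Vsharp Mod L) QZ" "\<And>u. u \<in> carrier Vsharp \<Longrightarrow> h' (L #>\<^bsub>Vsharp\<^esub> u) = h (cl (\<rho>V u))"
    using k.FactGroup_universal_kernel[OF Vsharp.subgroup_imp_normal[OF L_Vsharp]] by metis
  let ?h = "restrict h' (carrier G)"
  have "?h \<in> carrier HG"
    using h'(1) by (intro hom_group_restrictI G.is_group) (simp add: G_eq)
  moreover have "restrict ?h (carrier KD) = h"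
  proof (rule extensionalityI)
    show "restrict ?h (carrier KD) \<in> extensional (carrier KD)" by (rule restrict_extensional)
    show "h \<in> extensional (carrier KD)" using assms by (simp add: carrier_hom_group)
    fix X assume X: "X \<in> carrier KD"
    then obtain k r where k: "k \<in> carrier K" "X = cl (tens k r)" by (rule KD_cases)
    have "h' (cl (tens k r)) = h (cl (\<rho>V (tens k r)))"
      using h'(2)[of "tens k r"] k by (simp add: cl_Vsharp tens_K_Msharp)
    then show "restrict ?h (carrier KD) X = h X"
      using X k KD_G[OF X] by (simp add: \<rho>V_tens K_M \<rho>(3))
  qed
  ultimately show ?thesis by blast
qed

section \<open>The pairing of the cokernel with the discriminant group\<close>

abbreviation "A \<equiv> adj M f ` carrier M"
abbreviation "CA \<equiv> coker_adj M f"
abbreviation "ccl \<alpha> \<equiv> A #>\<^bsub>D\<^esub> \<alpha>"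

lemma A_normal: "A \<lhd> D"
  by (rule D.subgroup_imp_normal[OF adj_image_subgroup])

sublocale CA: comm_group CA
  unfolding coker_adj_def by (rule D.abelian_FactGroup[OF adj_image_subgroup])

lemma CA_cases:
  assumes "C \<in> carrier CA" obtains \<alpha> where "\<alpha> \<in> carrier D" "C = ccl \<alpha>"
  using assms by (auto simp: coker_adj_def carrier_FactGroup)

lemma ccl_closed: "\<alpha> \<in> carrier D \<Longrightarrow> ccl \<alpha> \<in> carrier CA"
  by (auto simp: coker_adj_def carrier_FactGroup)

lemma ccl_mult: "\<alpha> \<in> carrier D \<Longrightarrow> \<beta> \<in> carrier D \<Longrightarrow> ccl \<alpha> \<otimes>\<^bsub>CA\<^esub> ccl \<beta> = ccl (\<alpha> \<otimes>\<^bsub>D\<^esub> \<beta>)"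
  using normal.rcos_sum[OF A_normal] by (simp add: coker_adj_def)

lemma mem_ccl_iff: "\<beta> \<in> ccl \<alpha> \<longleftrightarrow> (\<exists>m\<in>carrier M. \<beta> = adj M f m \<otimes>\<^bsub>D\<^esub> \<alpha>)"
  by (auto simp: r_coset_def)

lemma mem_ccl_self: "\<alpha> \<in> carrier D \<Longrightarrow> \<alpha> \<in> ccl \<alpha>"
  by (rule D.rcos_self[OF _ adj_image_subgroup])

lemma coker_pairing_cl:
  assumes \<alpha>: "\<alpha> \<in> carrier D" and u: "u \<in> Msharp"
  shows "coker_pairing M f (ccl \<alpha>) (cl u) = mod_Z (dual_ext M \<alpha> u)"
proof -
  have "the_elem ((\<lambda>(\<alpha>, x). mod_Z (dual_ext M \<alpha> x)) ` (ccl \<alpha> \<times> cl u)) =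
      (\<lambda>(\<alpha>, x). mod_Z (dual_ext M \<alpha> x)) (\<alpha>, u)"
  proof (rule the_elem_image_const)
    show "(\<alpha>, u) \<in> ccl \<alpha> \<times> cl u" using \<alpha> u mem_ccl_self Msharp_V mem_cl_self by simp
    fix p assume "p \<in> ccl \<alpha> \<times> cl u"
    then obtain m x where mx: "m \<in> carrier M" "x \<in> carrier M" "p = (adj M f m \<otimes>\<^bsub>D\<^esub> \<alpha>, \<iota> x \<otimes>\<^bsub>V\<^esub> u)"
      by (auto simp: mem_cl_iff mem_ccl_iff)
    have "form_ext M f (\<iota> m) (\<iota> x) + form_ext M f (\<iota> m) u + of_int (\<alpha> x) \<in> \<int>"
      using mx u by (intro Ints_add form_ext_iota_Ints iota_Msharp Ints_of_int)
    then show "(\<lambda>(\<alpha>, x). mod_Z (dual_ext M \<alpha> x)) p = (\<lambda>(\<alpha>, x). mod_Z (dual_ext M \<alpha> x)) (\<alpha>, u)"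
      using mx \<alpha> u Msharp_V[OF u]
      by (simp add: mod_Z_eq_iff dual_ext_dual_simps dual_ext_mult dual_ext_tens form_ext_lattice algebra_simps)
  qed
  then show ?thesis using u by (simp add: coker_pairing_def)
qed

lemma coker_pairing_closed:
  assumes "C \<in> carrier CA"
  shows "coker_pairing M f C \<in> carrier HG"
proof -
  obtain \<alpha> where \<alpha>: "\<alpha> \<in> carrier D" "C = ccl \<alpha>" using assms by (rule CA_cases)
  have "coker_pairing M f C \<in> hom G QZ"
  proof (rule homI)
    fix X Y assume "X \<in> carrier G" "Y \<in> carrier G"
    then obtain u v where uv: "u \<in> Msharp" "v \<in> Msharp" "X = cl u" "Y = cl v" by (metis G_cases)
    have "u \<otimes>\<^bsub>V\<^esub> v \<in> Msharp" using uv by (simp add: subgroup.m_closed[OF Msharp_subgroup])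
    then show "coker_pairing M f C (X \<otimes>\<^bsub>G\<^esub> Y) = coker_pairing M f C X \<otimes>\<^bsub>QZ\<^esub> coker_pairing M f C Y"
      using uv \<alpha> by (simp add: cl_mult[symmetric] coker_pairing_cl mod_Z_mult dual_ext_mult Msharp_V)
  next
    fix X assume "X \<in> carrier G"
    then obtain u where "u \<in> Msharp" "X = cl u" by (rule G_cases)
    then show "coker_pairing M f C X \<in> carrier QZ" using \<alpha> by (simp add: coker_pairing_cl)
  qed
  then show ?thesis
    by (simp add: carrier_hom_group coker_pairing_def)
qed

lemma ccl_eq_iff:
  "\<alpha> \<in> carrier D \<Longrightarrow> \<beta> \<in> carrier D \<Longrightarrow> ccl \<alpha> = ccl \<beta> \<longleftrightarrow> \<alpha> \<otimes>\<^bsub>D\<^esub> inv\<^bsub>D\<^esub> \<beta> \<in> A"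
  by (rule D.coset_eq_iff[OF adj_image_subgroup])

lemma coker_pairing_hom: "coker_pairing M f \<in> hom CA HG"
proof (rule homI)
  fix B C assume "B \<in> carrier CA" "C \<in> carrier CA"
  then obtain \<alpha> \<beta> where ab: "\<alpha> \<in> carrier D" "\<beta> \<in> carrier D" "B = ccl \<alpha>" "C = ccl \<beta>"
    by (metis CA_cases)
  have *: "coker_pairing M f (ccl \<alpha> \<otimes>\<^bsub>CA\<^esub> ccl \<beta>) = coker_pairing M f (ccl (\<alpha> \<otimes>\<^bsub>D\<^esub> \<beta>))"
    using ab by (simp only: ccl_mult)
  have "coker_pairing M f (ccl (\<alpha> \<otimes>\<^bsub>D\<^esub> \<beta>)) = coker_pairing M f (ccl \<alpha>) \<otimes>\<^bsub>HG\<^esub> coker_pairing M f (ccl \<beta>)"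
  proof (rule hom_group_eqI)
    fix X assume X: "X \<in> carrier G"
    then obtain u where u: "u \<in> Msharp" "X = cl u" by (rule G_cases)
    have "(coker_pairing M f (ccl \<alpha>) \<otimes>\<^bsub>HG\<^esub> coker_pairing M f (ccl \<beta>)) X =
        coker_pairing M f (ccl \<alpha>) X \<otimes>\<^bsub>QZ\<^esub> coker_pairing M f (ccl \<beta>) X"
      using X by (rule mult_hom_group)
    then show "coker_pairing M f (ccl (\<alpha> \<otimes>\<^bsub>D\<^esub> \<beta>)) X = (coker_pairing M f (ccl \<alpha>) \<otimes>\<^bsub>HG\<^esub> coker_pairing M f (ccl \<beta>)) X"
      using u ab Msharp_V[OF u(1)] by (simp add: coker_pairing_cl mod_Z_mult dual_ext_dual_simps)
  qed (use ab in \<open>auto intro!: coker_pairing_closed ccl_closed HG.m_closed\<close>)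
  with * show "coker_pairing M f (B \<otimes>\<^bsub>CA\<^esub> C) = coker_pairing M f B \<otimes>\<^bsub>HG\<^esub> coker_pairing M f C"
    by (simp only: ab)
qed (rule coker_pairing_closed)

lemma coker_pairing_mon: "coker_pairing M f \<in> mon CA HG"
proof -
  have "B = C" if BC: "B \<in> carrier CA" "C \<in> carrier CA" and eq: "coker_pairing M f B = coker_pairing M f C" for B C
  proof -
    obtain \<alpha> \<beta> where ab: "\<alpha> \<in> carrier D" "\<beta> \<in> carrier D" "B = ccl \<alpha>" "C = ccl \<beta>"
      using BC by (metis CA_cases)
    have "\<alpha> \<otimes>\<^bsub>D\<^esub> inv\<^bsub>D\<^esub> \<beta> \<in> A"
    proof (rule integral_on_dual_lattice_imp_adj)
      fix u assume u: "u \<in> Msharp"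
      have "mod_Z (dual_ext M \<alpha> u) = mod_Z (dual_ext M \<beta> u)"
        using ab u eq coker_pairing_cl by metis
      then show "dual_ext M (\<alpha> \<otimes>\<^bsub>D\<^esub> inv\<^bsub>D\<^esub> \<beta>) u \<in> \<int>"
        using ab u by (simp add: dual_ext_dual_simps Msharp_V mod_Z_eq_iff)
    qed (use ab in simp)
    then show ?thesis using ab by (simp add: ccl_eq_iff)
  qed
  then show ?thesis by (auto simp: mon_def coker_pairing_hom inj_on_def)
qed

section \<open>The two cokernels\<close>

abbreviation "P \<equiv> coker_pairing M f ` carrier CA"
abbreviation "Res \<equiv> \<lambda>h. restrict h (carrier KD)"

lemma Res_closed:
  assumes "h \<in> carrier HG" shows "Res h \<in> carrier HK"
proof (rule hom_group_restrictI[OF KD.is_group])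
  show "h \<in> hom KD QZ"
    using assms KD_G by (auto simp: carrier_hom_group hom_def)
qed

lemma Res_hom: "group_hom HG HK Res"
proof -
  have "Res \<in> hom HG HK"
  proof (rule homI)
    fix g h assume gh: "g \<in> carrier HG" "h \<in> carrier HG"
    show "Res (g \<otimes>\<^bsub>HG\<^esub> h) = Res g \<otimes>\<^bsub>HK\<^esub> Res h"
      by (rule hom_group_eqI)
        (use gh in \<open>auto simp: Res_closed mult_hom_group KD_G intro!: HG.m_closed HK.m_closed\<close>)
  qed (rule Res_closed)
  then show ?thesis
    by (simp add: group_hom_def group_hom_axioms_def HG.is_group HK.is_group)
qed

lemma Res_pairing:
  assumes "\<alpha> \<in> carrier D"
  shows "Res (coker_pairing M f (ccl \<alpha>)) = j_map M f (restrict \<alpha> (carrier K))"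
proof (rule hom_group_eqI)
  show "Res (coker_pairing M f (ccl \<alpha>)) \<in> carrier HK"
    using assms by (intro Res_closed coker_pairing_closed ccl_closed)
  show "j_map M f (restrict \<alpha> (carrier K)) \<in> carrier HK"
    using assms by (intro group_hom.hom_closed[OF j_map_hom] dual_K_restrict)
  fix X assume "X \<in> carrier KD"
  then obtain k r where "k \<in> carrier K" "X = cl (tens k r)" by (rule KD_cases)
  then show "Res (coker_pairing M f (ccl \<alpha>)) X = j_map M f (restrict \<alpha> (carrier K)) X"
    using assms by (simp add: j_map_cl dual_K_restrict cl_tens_K coker_pairing_cl tens_K_Msharp dual_ext_tens K_M)
qed

text \<open>If \<open>h\<close> restricts to \<open>j(g)\<close>, extend \<open>g\<close> to a form \<open>\<alpha>\<close> on the lattice. Then \<open>h - \<langle>\<alpha>, -\<rangle>\<close> vanishes on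
  the kernel of the discriminant form and is therefore itself a pairing with some \<open>\<beta>\<close>.\<close>

lemma pairing_image_iff:
  assumes h: "h \<in> carrier HG"
  shows "h \<in> P \<longleftrightarrow> Res h \<in> J"
proof
  assume "h \<in> P"
  then obtain \<alpha> where "\<alpha> \<in> carrier D" "h = coker_pairing M f (ccl \<alpha>)" by (auto elim!: CA_cases)
  then show "Res h \<in> J" using Res_pairing dual_K_restrict by auto
next
  assume "Res h \<in> J"
  then obtain g where g: "g \<in> carrier (dual K)" "Res h = j_map M f g" by auto
  obtain \<alpha> where \<alpha>: "\<alpha> \<in> carrier D" "\<And>k. k \<in> carrier K \<Longrightarrow> \<alpha> k = g k"
    using dual_K_extends[OF g(1)] by blast
  have "restrict \<alpha> (carrier K) = g"
    using g(1) \<alpha> by (auto simp: carrier_dual_K intro: extensionalityI)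
  then have Res: "Res h = Res (coker_pairing M f (ccl \<alpha>))"
    using Res_pairing[OF \<alpha>(1)] g by simp
  define p where "p = coker_pairing M f (ccl \<alpha>)"
  have p: "p \<in> carrier HG" unfolding p_def using \<alpha> by (intro coker_pairing_closed ccl_closed)
  define h0 where "h0 = h \<otimes>\<^bsub>HG\<^esub> inv\<^bsub>HG\<^esub> p"
  have h0: "h0 \<in> carrier HG" using h p by (simp add: h0_def)
  have h_eq: "h = h0 \<otimes>\<^bsub>HG\<^esub> p" using h p by (simp add: h0_def HG.m_assoc)
  have "h0 X = \<one>\<^bsub>QZ\<^esub>" if X: "X \<in> carrier KD" for X
  proof -
    have eq: "h X = p X" using fun_cong[OF Res, of X] X by (simp add: p_def)
    interpret p: group_hom G QZ p using p by (rule hom_group_group_hom) simp_all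
    have "h0 X = h X \<otimes>\<^bsub>QZ\<^esub> inv\<^bsub>QZ\<^esub> p X"
      using p KD_G[OF X] by (simp add: h0_def mult_hom_group inv_hom_group)
    then show ?thesis using eq p.hom_closed[OF KD_G[OF X]] by (simp add: group.r_inv)
  qed
  from hom_vanishing_on_kernel_is_pairing[OF h0 this] obtain \<beta> where \<beta>: "\<beta> \<in> carrier D"
    "\<And>u. u \<in> Msharp \<Longrightarrow> h0 (cl u) = mod_Z (dual_ext M \<beta> u)" by blast
  have "h0 = coker_pairing M f (ccl \<beta>)"
  proof (rule hom_group_eqI[OF h0])
    show "coker_pairing M f (ccl \<beta>) \<in> carrier HG" using \<beta> by (intro coker_pairing_closed ccl_closed)
    fix X assume "X \<in> carrier G"
    then obtain u where "u \<in> Msharp" "X = cl u" by (rule G_cases)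
    then show "h0 X = coker_pairing M f (ccl \<beta>) X" using \<beta> by (simp add: coker_pairing_cl)
  qed
  then have "h = coker_pairing M f (ccl \<beta> \<otimes>\<^bsub>CA\<^esub> ccl \<alpha>)"
    using hom_mult[OF coker_pairing_hom ccl_closed[OF \<beta>(1)] ccl_closed[OF \<alpha>(1)]] h_eq by (simp only: p_def)
  moreover have "ccl \<beta> \<otimes>\<^bsub>CA\<^esub> ccl \<alpha> \<in> carrier CA"
    by (intro CA.m_closed ccl_closed \<alpha>(1) \<beta>(1))
  ultimately show "h \<in> P" by blast
qed

text \<open>The restriction of homomorphisms to the kernel of the discriminant form is onto, and the preimage of
  the image of \<open>j\<close> is the image of the pairing.\<close>

lemma coker_iso: "coker_phi M f \<cong> coker_j M f"
proof -
  have J: "J \<lhd> HK" by (rule HK.subgroup_imp_normal[OF J_subgroup])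
  interpret Q: comm_group "coker_j M f"
    unfolding coker_j_def by (rule HK.abelian_FactGroup[OF J_subgroup])
  let ?c = "\<lambda>h. J #>\<^bsub>HK\<^esub> Res h"
  have "(\<lambda>h. J #>\<^bsub>HK\<^esub> h) \<in> hom HK (coker_j M f)"
    unfolding coker_j_def by (rule normal.r_coset_hom_Mod[OF J])
  from Group.hom_compose[OF group_hom.homh[OF Res_hom] this]
  have "?c \<in> hom HG (coker_j M f)" by (simp add: comp_def)
  then interpret c: group_hom HG "coker_j M f" ?c
    by (simp add: group_hom_def group_hom_axioms_def HG.is_group Q.is_group)
  have "kernel HG (coker_j M f) ?c = P"
  proof -
    have "?c h = J \<longleftrightarrow> h \<in> P" if "h \<in> carrier HG" for h
      using HK.coset_eq_iff[OF J_subgroup Res_closed[OF that] HK.one_closed] Res_closed[OF that]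
        pairing_image_iff[OF that] HK.coset_mult_one[OF subgroup.subset[OF J_subgroup]] by simp
    moreover have "P \<subseteq> carrier HG" using coker_pairing_closed by auto
    moreover have "\<one>\<^bsub>coker_j M f\<^esub> = J" by (simp add: coker_j_def)
    ultimately show ?thesis by (auto simp: kernel_def)
  qed
  moreover have "?c ` carrier HG = carrier (coker_j M f)"
  proof
    show "?c ` carrier HG \<subseteq> carrier (coker_j M f)" using c.hom_closed by blast
    show "carrier (coker_j M f) \<subseteq> ?c ` carrier HG"
    proof
      fix C assume "C \<in> carrier (coker_j M f)"
      then obtain h where "h \<in> carrier HK" "C = J #>\<^bsub>HK\<^esub> h"
        by (auto simp: coker_j_def carrier_FactGroup)
      with HK_extends show "C \<in> ?c ` carrier HG" by blast
    qed
  qed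
  ultimately show ?thesis
    using c.FactGroup_iso by (simp add: coker_phi_def)
qed

section \<open>Characteristic forms\<close>

text \<open>Replacing \<open>u\<close> by \<open>x + u\<close> with \<open>x\<close> in the lattice adds \<open>(f(x, x) - c(x)) / 2 + f(x, u)\<close>, and both
  terms are integers: the first because \<open>c\<close> is characteristic, the second because \<open>u\<close> is in the
  dual lattice.\<close>

lemma phi_char_cl:
  assumes c: "c \<in> Char M f" and u: "u \<in> Msharp"
  shows "phi_char M f c (cl u) = mod_Z ((form_ext M f u u - dual_ext M c u) / 2)"
proof -
  have cD: "c \<in> carrier D" using c by (simp add: Char_def)
  have "the_elem ((\<lambda>x. mod_Z ((form_ext M f x x - dual_ext M c x) / 2)) ` cl u) =
      mod_Z ((form_ext M f u u - dual_ext M c u) / 2)"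
  proof (rule the_elem_image_const)
    show "u \<in> cl u" using u Msharp_V mem_cl_self by simp
    fix w assume "w \<in> cl u"
    then obtain x where x: "x \<in> carrier M" "w = \<iota> x \<otimes>\<^bsub>V\<^esub> u" by (auto simp: mem_cl_iff)
    have "even (f x x - c x)" using c x(1) unfolding Char_def by blast
    then obtain z where z: "f x x - c x = 2 * z" by (rule evenE)
    then have z': "of_int (f x x) - of_int (c x) = (2 * of_int z :: rat)" by (metis of_int_diff of_int_mult of_int_numeral)
    have sym: "form_ext M f u (\<iota> x) = form_ext M f (\<iota> x) u" using x u by (simp add: form_ext_sym Msharp_V)
    have "(form_ext M f w w - dual_ext M c w) / 2 - (form_ext M f u u - dual_ext M c u) / 2 =
        (of_int (f x x) - of_int (c x)) / 2 + form_ext M f (\<iota> x) u"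
      using x u cD sym
      by (simp add: Msharp_V form_ext_mult_left form_ext_mult_right form_ext_tens dual_ext_mult dual_ext_tens field_simps)
    also have "\<dots> \<in> \<int>" using x u by (simp add: z' form_ext_iota_Ints)
    finally show "mod_Z ((form_ext M f w w - dual_ext M c w) / 2) = mod_Z ((form_ext M f u u - dual_ext M c u) / 2)"
      by (simp add: mod_Z_eq_iff)
  qed
  then show ?thesis using u by (simp add: phi_char_def)
qed

lemma phi_char_funcset:
  assumes "c \<in> Char M f"
  shows "phi_char M f c \<in> carrier G \<rightarrow>\<^sub>E carrier QZ"
proof
  fix X assume "X \<in> carrier G"
  then obtain u where "u \<in> Msharp" "X = cl u" by (rule G_cases)
  then show "phi_char M f c X \<in> carrier QZ" using assms by (simp add: phi_char_cl)
qed (simp add: phi_char_def)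

lemma phi_char_polar:
  assumes c: "c \<in> Char M f" and XY: "X \<in> carrier G" "Y \<in> carrier G"
  shows "polar G (phi_char M f c) X Y = discr_form M f X Y"
proof -
  have cD: "c \<in> carrier D" using c by (simp add: Char_def)
  obtain u v where uv: "u \<in> Msharp" "v \<in> Msharp" "X = cl u" "Y = cl v" using XY by (metis G_cases)
  have m: "u \<otimes>\<^bsub>V\<^esub> v \<in> Msharp" using uv by (simp add: subgroup.m_closed[OF Msharp_subgroup])
  have "form_ext M f v u = form_ext M f u v" using uv by (simp add: form_ext_sym Msharp_V)
  then show ?thesis
    using uv m c cD
    by (simp add: polar_def cl_mult[symmetric] phi_char_cl discr_form_cl mod_Z_simps
        form_ext_mult_left form_ext_mult_right dual_ext_mult Msharp_V field_simps)
qed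

lemma phi_char_Quad:
  assumes c: "c \<in> Char M f"
  shows "phi_char M f c \<in> Quad G (discr_form M f)"
proof -
  have "bilinear_QZ G (polar G (phi_char M f c))"
    using discr_form_bilinear unfolding bilinear_QZ_def
    by (simp add: phi_char_polar[OF c])
  then show ?thesis
    using phi_char_funcset[OF c] phi_char_polar[OF c] by (simp add: Quad_def quadratic_function_def)
qed

abbreviation "sq \<alpha> \<equiv> \<alpha> [^]\<^bsub>D\<^esub> (2::nat)"

lemma char_shift:
  assumes c: "c \<in> Char M f" and \<alpha>: "\<alpha> \<in> carrier D"
  shows "c \<otimes>\<^bsub>D\<^esub> sq \<alpha> \<in> Char M f"
    and "u \<in> Msharp \<Longrightarrow> phi_char M f (c \<otimes>\<^bsub>D\<^esub> sq \<alpha>) (cl u) =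
      phi_char M f c (cl u) \<otimes>\<^bsub>QZ\<^esub> inv\<^bsub>QZ\<^esub> mod_Z (dual_ext M \<alpha> u)"
proof -
  have cD: "c \<in> carrier D" using c by (simp add: Char_def)
  show *: "c \<otimes>\<^bsub>D\<^esub> sq \<alpha> \<in> Char M f"
    using c \<alpha> cD by (auto simp: Char_def dual_simps)
  show "phi_char M f (c \<otimes>\<^bsub>D\<^esub> sq \<alpha>) (cl u) =
      phi_char M f c (cl u) \<otimes>\<^bsub>QZ\<^esub> inv\<^bsub>QZ\<^esub> mod_Z (dual_ext M \<alpha> u)" if "u \<in> Msharp"
    using that c * cD \<alpha>
    by (simp add: phi_char_cl mod_Z_simps dual_ext_dual_simps Msharp_V field_simps)
qed

text \<open>The difference of two characteristic forms has even values, so it can be halved.\<close>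

lemma char_diff:
  assumes c: "c \<in> Char M f" "c' \<in> Char M f"
  shows "\<exists>\<alpha>\<in>carrier D. c' = c \<otimes>\<^bsub>D\<^esub> sq \<alpha>"
proof -
  have cD: "c \<in> carrier D" "c' \<in> carrier D" using c by (auto simp: Char_def)
  have even: "even (c' x - c x)" if "x \<in> carrier M" for x
  proof -
    have "even (f x x - c x)" "even (f x x - c' x)" using c that unfolding Char_def by blast+
    then show ?thesis by presburger
  qed
  let ?\<alpha> = "restrict (\<lambda>x. (c' x - c x) div 2) (carrier M)"
  have \<alpha>: "?\<alpha> \<in> carrier D"
  proof (rule dual_restrictI)
    fix x y assume xy: "x \<in> carrier M" "y \<in> carrier M"
    have "c' (x \<otimes> y) - c (x \<otimes> y) = (c' x - c x) + (c' y - c y)"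
      using xy cD by (simp add: dual_apply_simps)
    then show "(c' (x \<otimes> y) - c (x \<otimes> y)) div 2 = (c' x - c x) div 2 + (c' y - c y) div 2"
      using even[OF xy(1)] by (simp add: div_plus_div_distrib_dvd_left)
  qed
  have "c' = c \<otimes>\<^bsub>D\<^esub> sq ?\<alpha>"
    by (rule dual_eqI) (use cD \<alpha> even in \<open>auto simp: dual_simps\<close>)
  with \<alpha> show ?thesis by blast
qed

abbreviation "SA \<equiv> (\<lambda>x. sq (adj M f x)) ` carrier M"

lemma SA_subgroup: "subgroup SA D"
proof -
  have "(\<lambda>x. sq (adj M f x)) \<in> hom M D"
    using group_hom.hom_mult[OF adj_hom] by (intro homI) (simp_all add: D.nat_pow_distrib)
  then have "group_hom M D (\<lambda>x. sq (adj M f x))"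
    by (simp add: group_hom_def group_hom_axioms_def D.is_group)
  then show ?thesis by (rule group_hom.img_is_subgroup)
qed

lemma mem_char_class_iff:
  "c' \<in> char_class M f c \<longleftrightarrow> (\<exists>m\<in>carrier M. c' = sq (adj M f m) \<otimes>\<^bsub>D\<^esub> c)"
  by (auto simp: char_class_def r_coset_def)

lemma mem_char_class_self: "c \<in> carrier D \<Longrightarrow> c \<in> char_class M f c"
  unfolding char_class_def by (rule D.rcos_self[OF _ SA_subgroup])

lemma char_class_shift:
  assumes "c \<in> carrier D" "m \<in> carrier M"
  shows "char_class M f (c \<otimes>\<^bsub>D\<^esub> sq (adj M f m)) = char_class M f c"
proof -
  have "c \<otimes>\<^bsub>D\<^esub> sq (adj M f m) \<otimes>\<^bsub>D\<^esub> inv\<^bsub>D\<^esub> c = sq (adj M f m)"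
    using assms by (simp add: D.m_comm[of c] D.m_assoc)
  then show ?thesis
    unfolding char_class_def using assms by (subst D.coset_eq_iff[OF SA_subgroup]) auto
qed

lemma phi_char_shift_adj:
  assumes c: "c \<in> Char M f" and m: "m \<in> carrier M"
  shows "phi_char M f (c \<otimes>\<^bsub>D\<^esub> sq (adj M f m)) = phi_char M f c"
proof (rule extensionalityI)
  fix X assume "X \<in> carrier G"
  then obtain u where u: "u \<in> Msharp" "X = cl u" by (rule G_cases)
  have 0: "mod_Z (dual_ext M (adj M f m) u) = mod_Z 0"
    using form_ext_iota_Ints(1)[OF m u(1)] m u(1)
    by (simp add: form_ext_lattice Msharp_V mod_Z_eq_iff)
  show "phi_char M f (c \<otimes>\<^bsub>D\<^esub> sq (adj M f m)) X = phi_char M f c X"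
    by (simp add: u(2) char_shift(2)[OF c adj_closed[OF m] u(1)] phi_char_cl[OF c u(1)] 0 mod_Z_simps)
qed (auto simp: phi_char_def)

lemma phi_map_class:
  assumes c: "c \<in> Char M f"
  shows "phi_map M f (char_class M f c) = phi_char M f c"
  unfolding phi_map_def
proof (rule the_elem_image_const)
  have cD: "c \<in> carrier D" using c by (simp add: Char_def)
  then show "c \<in> char_class M f c" by (rule mem_char_class_self)
  fix c' assume "c' \<in> char_class M f c"
  then obtain m where m: "m \<in> carrier M" "c' = sq (adj M f m) \<otimes>\<^bsub>D\<^esub> c" by (auto simp: mem_char_class_iff)
  then have "c' = c \<otimes>\<^bsub>D\<^esub> sq (adj M f m)" using cD by (simp add: D.m_comm)
  then show "phi_char M f c' = phi_char M f c" using phi_char_shift_adj[OF c m(1)] by simp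
qed

lemma phi_map_inj: "inj_on (phi_map M f) (Char_quot M f)"
proof (rule inj_onI)
  fix C C' assume "C \<in> Char_quot M f" "C' \<in> Char_quot M f" and eq: "phi_map M f C = phi_map M f C'"
  then obtain c c' where c: "c \<in> Char M f" "c' \<in> Char M f" "C = char_class M f c" "C' = char_class M f c'"
    by (auto simp: Char_quot_def)
  have cD: "c \<in> carrier D" using c by (simp add: Char_def)
  obtain \<alpha> where \<alpha>: "\<alpha> \<in> carrier D" "c' = c \<otimes>\<^bsub>D\<^esub> sq \<alpha>" using char_diff[OF c(1,2)] by blast
  have "phi_char M f c = phi_char M f c'" using eq c by (simp add: phi_map_class)
  then have eq': "phi_char M f c = phi_char M f (c \<otimes>\<^bsub>D\<^esub> sq \<alpha>)" by (simp only: \<alpha>(2))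
  have "dual_ext M \<alpha> u \<in> \<int>" if u: "u \<in> Msharp" for u
  proof -
    have "phi_char M f c (cl u) = phi_char M f c (cl u) \<otimes>\<^bsub>QZ\<^esub> inv\<^bsub>QZ\<^esub> mod_Z (dual_ext M \<alpha> u)"
      using char_shift(2)[OF c(1) \<alpha>(1) u] unfolding eq'[symmetric] .
    then show ?thesis by (simp add: phi_char_cl[OF c(1) u] mod_Z_simps mod_Z_eq_iff)
  qed
  then have "\<alpha> \<in> A" by (intro integral_on_dual_lattice_imp_adj \<alpha>(1))
  then show "C = C'" using c cD \<alpha>(2) char_class_shift by auto
qed

lemma phi_map_act:
  assumes B: "B \<in> carrier CA" and C: "C \<in> Char_quot M f"
  shows "phi_map M f (char_act M f B C) =
    (\<lambda>X\<in>carrier G. phi_map M f C X \<otimes>\<^bsub>QZ\<^esub> inv\<^bsub>QZ\<^esub> (coker_pairing M f B X))"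
proof -
  obtain \<alpha> where \<alpha>: "\<alpha> \<in> carrier D" "B = ccl \<alpha>" using B by (rule CA_cases)
  obtain c where c: "c \<in> Char M f" "C = char_class M f c" using C by (auto simp: Char_quot_def)
  have cD: "c \<in> carrier D" using c by (simp add: Char_def)
  let ?h = "\<lambda>(\<alpha>, c). char_class M f (c \<otimes>\<^bsub>D\<^esub> sq \<alpha>)"
  have "the_elem (?h ` (B \<times> C)) = ?h (\<alpha>, c)"
  proof (rule the_elem_image_const)
    show "(\<alpha>, c) \<in> B \<times> C" using \<alpha> c cD mem_ccl_self mem_char_class_self by simp
    fix p assume "p \<in> B \<times> C"
    then obtain m n where mn: "m \<in> carrier M" "n \<in> carrier M"
      "p = (adj M f m \<otimes>\<^bsub>D\<^esub> \<alpha>, sq (adj M f n) \<otimes>\<^bsub>D\<^esub> c)"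
      by (auto simp: \<alpha>(2) c(2) mem_char_class_iff mem_ccl_iff)
    have "sq (adj M f n) \<otimes>\<^bsub>D\<^esub> c \<otimes>\<^bsub>D\<^esub> sq (adj M f m \<otimes>\<^bsub>D\<^esub> \<alpha>) =
        c \<otimes>\<^bsub>D\<^esub> sq \<alpha> \<otimes>\<^bsub>D\<^esub> sq (adj M f (m \<otimes> n))"
      using mn \<alpha> cD group_hom.hom_mult[OF adj_hom] by (simp add: D.nat_pow_distrib D.m_ac)
    then show "?h p = ?h (\<alpha>, c)"
      using mn \<alpha> cD char_class_shift[of "c \<otimes>\<^bsub>D\<^esub> sq \<alpha>" "m \<otimes> n"] by simp
  qed
  then have act: "char_act M f B C = char_class M f (c \<otimes>\<^bsub>D\<^esub> sq \<alpha>)"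
    by (simp add: char_act_def)
  have "phi_map M f (char_act M f B C) = phi_char M f (c \<otimes>\<^bsub>D\<^esub> sq \<alpha>)"
    by (simp only: act phi_map_class[OF char_shift(1)[OF c(1) \<alpha>(1)]])
  also have "phi_char M f (c \<otimes>\<^bsub>D\<^esub> sq \<alpha>) =
    (\<lambda>X\<in>carrier G. phi_char M f c X \<otimes>\<^bsub>QZ\<^esub> inv\<^bsub>QZ\<^esub> (coker_pairing M f (ccl \<alpha>) X))"
  proof (rule extensionalityI)
    fix X assume X: "X \<in> carrier G"
    then obtain u where "u \<in> Msharp" "X = cl u" by (rule G_cases)
    then show "phi_char M f (c \<otimes>\<^bsub>D\<^esub> sq \<alpha>) X =
      (\<lambda>X\<in>carrier G. phi_char M f c X \<otimes>\<^bsub>QZ\<^esub> inv\<^bsub>QZ\<^esub> (coker_pairing M f (ccl \<alpha>) X)) X"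
      using X char_shift(2)[OF c(1) \<alpha>(1)] \<alpha>(1) by (simp add: coker_pairing_cl)
  qed (auto simp: phi_char_def)
  also have "\<dots> = (\<lambda>X\<in>carrier G. phi_map M f C X \<otimes>\<^bsub>QZ\<^esub> inv\<^bsub>QZ\<^esub> (coker_pairing M f B X))"
    by (simp only: c(2) \<alpha>(2) phi_map_class[OF c(1)])
  finally show ?thesis .
qed

text \<open>Modulo 2 the function \<open>x \<mapsto> f(x, x)\<close> is additive, so a form that agrees with it on a basis is
  characteristic.\<close>

lemma Char_nonempty: "\<exists>c. c \<in> Char M f"
proof (rule basis)
  fix n :: nat and e
  assume e: "\<And>i. i < n \<Longrightarrow> e i \<in> carrier M" and gen: "carrier M = generate M (e ` {..<n})"
    and ex: "\<And>z. \<exists>\<alpha>\<in>carrier D. \<forall>i<n. \<alpha> (e i) = z i"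
  obtain c where c: "c \<in> carrier D" "\<forall>i<n. c (e i) = f (e i) (e i)"
    using ex[of "\<lambda>i. f (e i) (e i)"] by blast
  have f_one: "f \<one> \<one> = 0" using f_add[of \<one> \<one> \<one>] by simp
  have f_inv: "f (inv x) (inv x) = f x x" if "x \<in> carrier M" for x
  proof -
    have "f (inv x) y = - f x y" if "y \<in> carrier M" for y
      using that \<open>x \<in> carrier M\<close> f_add[of x "inv x" y] f_add[of \<one> \<one> y] by simp
    then show ?thesis using that f_sym[of x "inv x"] by simp
  qed
  have "x \<in> carrier M \<and> even (f x x - c x)" if "x \<in> generate M (e ` {..<n})" for x
    using that
  proof induction
    case one
    then show ?case using f_one dual_apply_simps(1)[OF c(1) one_closed] by simp
  next
    case (incl x)
    then show ?case using e c by auto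
  next
    case (inv x)
    then show ?case using e c f_inv by (auto simp: dual_apply_simps)
  next
    case (eng x y)
    then have "f (x \<otimes> y) (x \<otimes> y) - c (x \<otimes> y) = (f x x - c x) + (f y y - c y) + 2 * f x y"
      using c f_sym[of x y] by (simp add: f_add f_add_right dual_apply_simps)
    then show ?case using eng by simp
  qed
  then show ?thesis using c gen by (auto simp: Char_def)
qed

text \<open>On the radical \<open>f\<close> vanishes; hence \<open>c\<close> is even there and the quadratic function maps \<open>k \<otimes> r\<close> to
  \<open>- r c(k) / 2\<close>, which is the image under \<open>j\<close> of \<open>- c / 2\<close>.\<close>

lemma Res_phi_char:
  assumes c: "c \<in> Char M f"
  shows "Res (phi_char M f c) \<in> J"
proof -
  have cD: "c \<in> carrier D" using c by (simp add: Char_def)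
  have even: "even (c k)" if "k \<in> carrier K" for k
    using c that by (auto simp: Char_def carrier_K dest!: bspec[of _ _ k])
  let ?g = "restrict (\<lambda>k. - (c k div 2)) (carrier K)"
  have g: "?g \<in> carrier (dual K)"
    unfolding dual_def
  proof (rule hom_group_restrictI[OF K.is_group], rule homI)
    fix k l assume kl: "k \<in> carrier K" "l \<in> carrier K"
    show "- (c (k \<otimes>\<^bsub>K\<^esub> l) div 2) = - (c k div 2) \<otimes>\<^bsub>integer_group\<^esub> - (c l div 2)"
      using kl cD even by (simp add: dual_apply_simps K_M div_plus_div_distrib_dvd_left)
  qed simp
  have "Res (phi_char M f c) = j_map M f ?g"
  proof (rule extensionalityI)
    show "j_map M f ?g \<in> extensional (carrier KD)" by (simp add: j_map_def)
    show "Res (phi_char M f c) \<in> extensional (carrier KD)" by (rule restrict_extensional)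
    fix X assume X: "X \<in> carrier KD"
    then obtain k r where k: "k \<in> carrier K" "X = cl (tens k r)" by (rule KD_cases)
    obtain z where z: "c k = 2 * z" using even[OF k(1)] by (rule evenE)
    show "Res (phi_char M f c) X = j_map M f ?g X"
      using X k c cD g
      by (simp add: j_map_cl phi_char_cl tens_K_Msharp form_ext_K K_M dual_ext_tens z)
  qed
  with g show ?thesis by blast
qed

lemma Quad_add:
  assumes q: "q \<in> Quad G b" and XY: "X \<in> carrier G" "Y \<in> carrier G"
  shows "q (X \<otimes>\<^bsub>G\<^esub> Y) = b X Y \<otimes>\<^bsub>QZ\<^esub> q X \<otimes>\<^bsub>QZ\<^esub> q Y"
proof -
  have closed: "q Z \<in> carrier QZ" if "Z \<in> carrier G" for Z
    using q that by (auto simp: Quad_def quadratic_function_def)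
  have b: "b X Y = q (X \<otimes>\<^bsub>G\<^esub> Y) \<otimes>\<^bsub>QZ\<^esub> inv\<^bsub>QZ\<^esub> (q X) \<otimes>\<^bsub>QZ\<^esub> inv\<^bsub>QZ\<^esub> (q Y)"
    using q XY by (auto simp: Quad_def polar_def)
  obtain x y z where "q X = mod_Z x" "q Y = mod_Z y" "q (X \<otimes>\<^bsub>G\<^esub> Y) = mod_Z z"
    using closed XY G.m_closed QZ_cases by metis
  then show ?thesis by (simp add: b mod_Z_simps)
qed

lemma Quad_diff_hom:
  assumes q: "q \<in> Quad G b" "q' \<in> Quad G b"
  shows "(\<lambda>X\<in>carrier G. q X \<otimes>\<^bsub>QZ\<^esub> inv\<^bsub>QZ\<^esub> q' X) \<in> carrier HG"
proof (rule hom_group_restrictI[OF G.is_group], rule homI)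
  have closed: "\<exists>z. p Z = mod_Z z" if "Z \<in> carrier G" "p \<in> Quad G b" for Z p
    using that QZ_cases by (auto simp: Quad_def quadratic_function_def)
  show "q X \<otimes>\<^bsub>QZ\<^esub> inv\<^bsub>QZ\<^esub> q' X \<in> carrier QZ" if "X \<in> carrier G" for X
    using closed[OF that q(1)] closed[OF that q(2)] by (auto simp: mod_Z_simps)
  fix X Y assume XY: "X \<in> carrier G" "Y \<in> carrier G"
  obtain x y x' y' where r: "q X = mod_Z x" "q Y = mod_Z y" "q' X = mod_Z x'" "q' Y = mod_Z y'"
    using closed XY q by metis
  have "b X Y = polar G q X Y" "bilinear_QZ G (polar G q)"
    using q(1) XY by (auto simp: Quad_def quadratic_function_def)
  then obtain z where z: "b X Y = mod_Z z" using XY QZ_cases unfolding bilinear_QZ_def by metis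
  show "q (X \<otimes>\<^bsub>G\<^esub> Y) \<otimes>\<^bsub>QZ\<^esub> inv\<^bsub>QZ\<^esub> q' (X \<otimes>\<^bsub>G\<^esub> Y) =
      (q X \<otimes>\<^bsub>QZ\<^esub> inv\<^bsub>QZ\<^esub> q' X) \<otimes>\<^bsub>QZ\<^esub> (q Y \<otimes>\<^bsub>QZ\<^esub> inv\<^bsub>QZ\<^esub> q' Y)"
    using XY q by (simp add: Quad_add r z mod_Z_simps algebra_simps)
qed

text \<open>Compare \<open>q\<close> with the function of one characteristic form \<open>c\<close>. The difference is a homomorphism whose
  restriction to the kernel lies in the image of \<open>j\<close>, so it is the pairing with some \<open>\<alpha>\<close>, and \<open>q\<close> is
  the function of \<open>c - 2 \<alpha>\<close>.\<close>

lemma phi_map_image_iff: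
  assumes q: "q \<in> Quad G (discr_form M f)"
  shows "q \<in> phi_map M f ` Char_quot M f \<longleftrightarrow> Res q \<in> J"
proof
  assume "q \<in> phi_map M f ` Char_quot M f"
  then obtain c where "c \<in> Char M f" "q = phi_char M f c"
    by (auto simp: Char_quot_def phi_map_class)
  then show "Res q \<in> J" using Res_phi_char by simp
next
  assume Rq: "Res q \<in> J"
  obtain c where c: "c \<in> Char M f" using Char_nonempty by blast
  let ?p = "phi_char M f c"
  have p: "?p \<in> Quad G (discr_form M f)" using c by (rule phi_char_Quad)
  define h where "h = (\<lambda>X\<in>carrier G. q X \<otimes>\<^bsub>QZ\<^esub> inv\<^bsub>QZ\<^esub> ?p X)"
  have h: "h \<in> carrier HG" unfolding h_def by (rule Quad_diff_hom[OF q p])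
  have Rp: "Res ?p \<in> J" using c by (rule Res_phi_char)
  have JHK: "J \<subseteq> carrier HK" by (rule subgroup.subset[OF J_subgroup])
  have "Res h = Res q \<otimes>\<^bsub>HK\<^esub> inv\<^bsub>HK\<^esub> Res ?p"
  proof (rule hom_group_eqI)
    show "Res h \<in> carrier HK" using h by (rule Res_closed)
    show "Res q \<otimes>\<^bsub>HK\<^esub> inv\<^bsub>HK\<^esub> Res ?p \<in> carrier HK" using Rq Rp JHK by blast
    fix X assume X: "X \<in> carrier KD"
    have "(inv\<^bsub>HK\<^esub> Res ?p) X = inv\<^bsub>QZ\<^esub> (Res ?p X)"
      using Rp JHK X by (intro inv_hom_group) auto
    then show "Res h X = (Res q \<otimes>\<^bsub>HK\<^esub> inv\<^bsub>HK\<^esub> Res ?p) X"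
      using X by (simp add: mult_hom_group h_def KD_G)
  qed
  then have "Res h \<in> J"
    using Rq Rp J_subgroup by (simp only: subgroup.m_closed subgroup.m_inv_closed)
  then have "h \<in> P" using h pairing_image_iff by blast
  then obtain \<alpha> where \<alpha>: "\<alpha> \<in> carrier D" "h = coker_pairing M f (ccl \<alpha>)" by (auto elim!: CA_cases)
  have "q = phi_char M f (c \<otimes>\<^bsub>D\<^esub> sq (inv\<^bsub>D\<^esub> \<alpha>))"
  proof (rule extensionalityI)
    show "q \<in> extensional (carrier G)"
      using q by (auto simp: Quad_def quadratic_function_def PiE_def)
    fix X assume X: "X \<in> carrier G"
    then obtain u where u: "u \<in> Msharp" "X = cl u" by (rule G_cases)
    obtain y z where yz: "q X = mod_Z y" "?p X = mod_Z z"
      using q p X QZ_cases by (auto simp: Quad_def quadratic_function_def) (metis PiE_mem)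
    have "mod_Z (y - z) = h X" using X by (simp add: h_def yz mod_Z_simps)
    also have "\<dots> = mod_Z (dual_ext M \<alpha> u)" using u \<alpha> by (simp add: coker_pairing_cl)
    finally have eq: "mod_Z (y - z) = mod_Z (dual_ext M \<alpha> u)" .
    have "mod_Z y = mod_Z z \<otimes>\<^bsub>QZ\<^esub> mod_Z (y - z)" by (simp add: mod_Z_simps)
    also have "\<dots> = mod_Z z \<otimes>\<^bsub>QZ\<^esub> inv\<^bsub>QZ\<^esub> mod_Z (dual_ext M (inv\<^bsub>D\<^esub> \<alpha>) u)"
      using u \<alpha> by (simp add: eq mod_Z_inv dual_ext_dual_simps Msharp_V)
    finally show "q X = phi_char M f (c \<otimes>\<^bsub>D\<^esub> sq (inv\<^bsub>D\<^esub> \<alpha>)) X"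
      using char_shift(2)[OF c, of "inv\<^bsub>D\<^esub> \<alpha>" u] \<alpha> u yz by simp
  qed (simp add: phi_char_def)
  moreover have "c \<otimes>\<^bsub>D\<^esub> sq (inv\<^bsub>D\<^esub> \<alpha>) \<in> Char M f" using c \<alpha> by (intro char_shift) simp_all
  ultimately show "q \<in> phi_map M f ` Char_quot M f"
    unfolding Char_quot_def by (metis phi_map_class imageI)
qed

end

theorem theorem2p10:
  fixes M :: "('a, 'm) monoid_scheme" and f :: "'a \<Rightarrow> 'a \<Rightarrow> int"
  assumes "bilinear_lattice M f"
  shows
    "(\<forall>c\<in>Char M f. phi_char M f c \<in> Quad (discr_group M f) (discr_form M f) \<and>
        phi_map M f (char_class M f c) = phi_char M f c) \<and>
     inj_on (phi_map M f) (Char_quot M f) \<and>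
     coker_pairing M f \<in> mon (coker_adj M f) (hom_group (discr_group M f) QZ) \<and>
     (\<forall>A\<in>carrier (coker_adj M f). \<forall>C\<in>Char_quot M f.
        phi_map M f (char_act M f A C) =
          (\<lambda>X\<in>carrier (discr_group M f).
             phi_map M f C X \<otimes>\<^bsub>QZ\<^esub> inv\<^bsub>QZ\<^esub> (coker_pairing M f A X))) \<and>
     coker_phi M f \<cong> coker_j M f \<and>
     (\<forall>q\<in>Quad (discr_group M f) (discr_form M f).
        q \<in> phi_map M f ` Char_quot M f \<longleftrightarrow>
        restrict q (carrier (ker_discr_adj M f)) \<in> j_map M f ` carrier (dual (ker_adj M f)))"
proof -
  interpret bilinear_lattice M f by fact
  show ?thesis
    using phi_char_Quad phi_map_class phi_map_inj coker_pairing_mon phi_map_act coker_iso phi_map_image_iff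
    by blast
qed

end
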